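(* Let $\gamma=((\gamma_1,\delta_1),\dots,(\gamma_{n-2},\delta_{n-2}))$ be dense. (1) Let $I$ be an ideal of $C_\gamma$ and let $Q$ be a prime ideal of $A_\gamma$ that is minimal over $IA_\gamma$. Then $Q$ is a Poisson prime ideal of $A_\gamma$. (2) If $Q$ is a nonzero proper Poisson prime ideal of $A_\gamma$, then $\mathrm{ht}(Q)=\mathrm{ht}(Q\cap C_\gamma)$. (3) If $Q$ is a nonzero proper Poisson prime ideal of $A_\gamma$, then $Q$ is a minimal prime ideal over $(Q\cap C_\gamma)A_\gamma$.
   Context: Let $n\ge 3$, $A=\mathbb{C}[x_1,\dots,x_n]$. Fix $s_1,t_1,\dots,s_{n-2},t_{n-2}\in A$ with each $t_i\ne 0$ and $s_i,t_i$ coprime, such that $s_1/t_1,\dots,s_{n-2}/t_{n-2}$ are algebraically independent over $\mathbb{C}$. $A$ carries the Poisson bracket $\{f,g\}=(t_1\cdots t_{n-2})^2\,\mathrm{Jac}(f,g,s_1/t_1,\dots,s_{n-2}/t_{n-2})$ ($\mathrm{Jac}$ = Jacobian determinant with respect to $x_1,\dots,x_n$), and every localization of $A$ inherits a Poisson bracket via the quotient rule. A sequence $\gamma=((\gamma_1,\delta_1),\dots,(\gamma_{n-2},\delta_{n-2}))\in(\{0,1\}\times\{0,1\})^{n-2}$ is dense if $(\gamma_i,\delta_i)\neq(0,0)$ for all $i$. For such $\gamma$: $S_\gamma\subseteq\{s_1,\dots,s_{n-2},t_1,\dots,t_{n-2}\}$ with $s_i\in S_\gamma\iff\gamma_i=1$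 and $t_i\in S_\gamma\iff\delta_i=1$; $M_\gamma$ is the multiplicatively closed subset of $A$ generated by $S_\gamma$; $A_\gamma=M_\gamma^{-1}A$; $v_i=s_i/t_i$ if $\delta_i=1$ and $v_i=t_i/s_i$ otherwise (so $v_i\in A_\gamma$); and $C_\gamma$ is the subalgebra of $A_\gamma$ generated by $v_1,\dots,v_{n-2}$. A Poisson prime ideal of $A_\gamma$ is a prime ideal $Q$ with $\{Q,A_\gamma\}\subseteq Q$; it is proper if the induced bracket on $A_\gamma/Q$ is nonzero. $\mathrm{ht}$ denotes height. *)

theory Defs
  imports Complex_Main "HOL-Library.Poly_Mapping" "HOL-Library.Extended_Nat" "HOL-Computational_Algebra.Fraction_Field"
          "HOL-Combinatorics.Permutations"
begin

text \<open>Polynomials in countably many variables x_0, x_1, ... over the complex numbers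
  (monomials are finitely supported exponent vectors).  The ring A = C[x_1..x_n] is the
  subset Apoly n of polynomials involving only the variables x_0..x_(n-1).
  Rational functions are elements of the fraction field.\<close>

type_synonym mpoly = "(nat \<Rightarrow>\<^sub>0 nat) \<Rightarrow>\<^sub>0 complex"
type_synonym ratfn = "mpoly fract"

definition Apoly :: "nat \<Rightarrow> mpoly set" where
  "Apoly n = {p. \<forall>m\<in>Poly_Mapping.keys p. \<forall>i\<in>Poly_Mapping.keys m. i < n}"

definition coprime_in :: "nat \<Rightarrow> mpoly \<Rightarrow> mpoly \<Rightarrow> bool" where
  "coprime_in n a b \<longleftrightarrow> (\<forall>c\<in>Apoly n. (\<exists>d\<in>Apoly n. a = c * d) \<and> (\<exists>d\<in>Apoly n. b = c * d)
      \<longrightarrow> (\<exists>u\<in>Apoly n. c * u = 1))"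

definition mp_const :: "complex \<Rightarrow> mpoly" where
  "mp_const c = Poly_Mapping.single 0 c"

definition mp_pderiv :: "nat \<Rightarrow> mpoly \<Rightarrow> mpoly" where
  "mp_pderiv i p = (\<Sum>m\<in>Poly_Mapping.keys p.
      Poly_Mapping.single (m - Poly_Mapping.single i 1) (of_nat (Poly_Mapping.lookup m i) * Poly_Mapping.lookup p m))"

definition fr_pderiv :: "nat \<Rightarrow> ratfn \<Rightarrow> ratfn" where
  "fr_pderiv i x = (case (SOME (a, b). b \<noteq> 0 \<and> x = Fract a b) of (a, b) \<Rightarrow>
      Fract (mp_pderiv i a * b - a * mp_pderiv i b) (b * b))"

definition jac :: "nat \<Rightarrow> (nat \<Rightarrow> ratfn) \<Rightarrow> ratfn" where
  "jac n F = (\<Sum>p | p permutes {..<n}. of_int (sign p) * (\<Prod>k<n. fr_pderiv (p k) (F k)))"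

definition pbr :: "nat \<Rightarrow> (nat \<Rightarrow> mpoly) \<Rightarrow> (nat \<Rightarrow> mpoly) \<Rightarrow> ratfn \<Rightarrow> ratfn \<Rightarrow> ratfn" where
  "pbr n s t f g = (Fract (\<Prod>i<n-2. t i) 1)^2 *
     jac n (\<lambda>k. if k = 0 then f else if k = 1 then g else Fract (s (k-2)) (t (k-2)))"

definition mp_eval :: "mpoly \<Rightarrow> (nat \<Rightarrow> ratfn) \<Rightarrow> ratfn" where
  "mp_eval P x = (\<Sum>m\<in>Poly_Mapping.keys P. Fract (mp_const (Poly_Mapping.lookup P m)) 1 * (\<Prod>i\<in>Poly_Mapping.keys m. x i ^ Poly_Mapping.lookup m i))"

definition alg_indep :: "nat \<Rightarrow> (nat \<Rightarrow> ratfn) \<Rightarrow> bool" where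
  "alg_indep k x \<longleftrightarrow> (\<forall>P\<in>Apoly k. P \<noteq> 0 \<longrightarrow> mp_eval P x \<noteq> 0)"

definition dense_seq :: "nat \<Rightarrow> (nat \<Rightarrow> bool) \<Rightarrow> (nat \<Rightarrow> bool) \<Rightarrow> bool" where
  "dense_seq n gam del \<longleftrightarrow> (\<forall>i<n-2. gam i \<or> del i)"

definition Mgam :: "nat \<Rightarrow> (nat \<Rightarrow> mpoly) \<Rightarrow> (nat \<Rightarrow> mpoly) \<Rightarrow> (nat \<Rightarrow> bool) \<Rightarrow> (nat \<Rightarrow> bool) \<Rightarrow> mpoly set" where
  "Mgam n s t gam del = {\<Prod>i<n-2. s i ^ a i * t i ^ b i | a b.
      \<forall>i<n-2. (\<not> gam i \<longrightarrow> a i = 0) \<and> (\<not> del i \<longrightarrow> b i = 0)}"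

definition Agam :: "nat \<Rightarrow> (nat \<Rightarrow> mpoly) \<Rightarrow> (nat \<Rightarrow> mpoly) \<Rightarrow> (nat \<Rightarrow> bool) \<Rightarrow> (nat \<Rightarrow> bool) \<Rightarrow> ratfn set" where
  "Agam n s t gam del = {Fract a m | a m. a \<in> Apoly n \<and> m \<in> Mgam n s t gam del}"

definition vgam :: "(nat \<Rightarrow> mpoly) \<Rightarrow> (nat \<Rightarrow> mpoly) \<Rightarrow> (nat \<Rightarrow> bool) \<Rightarrow> nat \<Rightarrow> ratfn" where
  "vgam s t del i = (if del i then Fract (s i) (t i) else Fract (t i) (s i))"

definition Cgam :: "nat \<Rightarrow> (nat \<Rightarrow> mpoly) \<Rightarrow> (nat \<Rightarrow> mpoly) \<Rightarrow> (nat \<Rightarrow> bool) \<Rightarrow> ratfn set" where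
  "Cgam n s t del = {mp_eval P (vgam s t del) | P. P \<in> Apoly (n-2)}"

definition ideal_in :: "ratfn set \<Rightarrow> ratfn set \<Rightarrow> bool" where
  "ideal_in R I \<longleftrightarrow> I \<subseteq> R \<and> 0 \<in> I \<and> (\<forall>a\<in>I. \<forall>b\<in>I. a + b \<in> I) \<and> (\<forall>r\<in>R. \<forall>a\<in>I. r * a \<in> I)"

definition prime_in :: "ratfn set \<Rightarrow> ratfn set \<Rightarrow> bool" where
  "prime_in R P \<longleftrightarrow> ideal_in R P \<and> P \<noteq> R \<and> (\<forall>a\<in>R. \<forall>b\<in>R. a * b \<in> P \<longrightarrow> a \<in> P \<or> b \<in> P)"

definition ideal_gen :: "ratfn set \<Rightarrow> ratfn set \<Rightarrow> ratfn set" where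
  "ideal_gen R X = \<Inter>{I. ideal_in R I \<and> X \<subseteq> I}"

definition minimal_prime_over :: "ratfn set \<Rightarrow> ratfn set \<Rightarrow> ratfn set \<Rightarrow> bool" where
  "minimal_prime_over R J Q \<longleftrightarrow> prime_in R Q \<and> J \<subseteq> Q \<and>
     (\<forall>P. prime_in R P \<and> J \<subseteq> P \<and> P \<subseteq> Q \<longrightarrow> P = Q)"

definition height_in :: "ratfn set \<Rightarrow> ratfn set \<Rightarrow> enat" where
  "height_in R P = Sup {enat k | k. \<exists>c :: nat \<Rightarrow> ratfn set.
      (\<forall>j\<le>k. prime_in R (c j)) \<and> (\<forall>j<k. c j \<subset> c (Suc j)) \<and> c k = P}"

definition poisson_prime :: "ratfn set \<Rightarrow> (ratfn \<Rightarrow> ratfn \<Rightarrow> ratfn) \<Rightarrow> ratfn set \<Rightarrow> bool" where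
  "poisson_prime R br Q \<longleftrightarrow> prime_in R Q \<and> (\<forall>a\<in>Q. \<forall>b\<in>R. br a b \<in> Q)"

text \<open>Proper: the induced bracket on R/Q is nonzero.\<close>
definition proper_pp :: "ratfn set \<Rightarrow> (ratfn \<Rightarrow> ratfn \<Rightarrow> ratfn) \<Rightarrow> ratfn set \<Rightarrow> bool" where
  "proper_pp R br Q \<longleftrightarrow> (\<exists>f\<in>R. \<exists>g\<in>R. br f g \<notin> Q)"

end

theory Submission
  imports Defs "Jordan_Normal_Form.Determinant"
begin

text \<open>For a prime \<open>Q\<close>, consider derivations of \<open>R/Q\<close> with values in its quotient field. In
  characteristic 0 an element \<open>a\<close> is algebraic over \<open>K[S]\<close> modulo \<open>Q\<close> iff every such derivation
  vanishing on \<open>S\<close> vanishes at \<open>a\<close>; this closure operator has the exchange property and gives a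
  transcendence degree, and in a localized polynomial ring in \<open>N\<close> variables the height of \<open>Q\<close> is \<open>N\<close>
  minus that degree. The bound from above holds because the degree drops strictly along inclusions
  of primes. For the bound from below one passes from \<open>Q\<close> to the largest ideal inside \<open>Q\<close> stable
  under \<open>\<partial>/\<partial>x_z\<close>, for one algebraic variable \<open>x_z\<close> after the other.

  Elements of \<open>C\<close> are Poisson central, so an ideal generated by them is stable under all Hamiltonian
  derivations, and so is any minimal prime over it. If \<open>Q\<close> is a proper Poisson prime with
  \<open>{f, g} \<notin> Q\<close>, and \<open>E\<close> is a transcendence basis of \<open>C\<close> modulo \<open>Q \<inter> C\<close>, then \<open>E \<union> {f, g}\<close> is
  one of \<open>A\<close> modulo \<open>Q\<close>: it is independent since \<open>{\<cdot>, g}\<close> and \<open>{\<cdot>, f}\<close> kill \<open>C\<close> and preserve \<open>Q\<close>,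
  and spanning since the Jacobian matrix of \<open>f, g, v_1, ..., v_(n-2)\<close> is invertible modulo \<open>Q\<close>.
  Hence the degrees differ by 2, as do the numbers of variables. The spanning part uses only
  \<open>{f, g} \<notin> Q\<close>, so it also applies to primes between \<open>(Q \<inter> C)A\<close> and \<open>Q\<close>, whence minimality.\<close>

text \<open>Characteristic 0 of the rational function field is used throughout: for division by
  factorials and for cancelling the integer factors that differentiation produces.\<close>

instance fract :: ("{idom, ring_char_0}") field_char_0
proof
  show "inj (of_nat :: nat \<Rightarrow> 'a fract)"
    by (rule injI) (simp add: of_nat_fract eq_fract)
qed

section \<open>Subrings, adjunction of one element, generated subrings\<close>

definition is_subring :: "'a::comm_ring_1 set \<Rightarrow> bool" where
  "is_subring S \<longleftrightarrow> 1 \<in> S \<and> (\<forall>a\<in>S. \<forall>b\<in>S. a - b \<in> S \<and> a * b \<in> S)"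

context
  fixes S :: "'a::comm_ring_1 set"
  assumes S: "is_subring S"
begin

lemma subring_one: "1 \<in> S"
  and subring_diff: "a \<in> S \<Longrightarrow> b \<in> S \<Longrightarrow> a - b \<in> S"
  and subring_mult: "a \<in> S \<Longrightarrow> b \<in> S \<Longrightarrow> a * b \<in> S"
  using S by (auto simp: is_subring_def)

lemma subring_zero: "0 \<in> S"
  using subring_diff[OF subring_one subring_one] by simp

lemma subring_uminus: "a \<in> S \<Longrightarrow> - a \<in> S"
  using subring_diff[OF subring_zero] by simp

lemma subring_add: "a \<in> S \<Longrightarrow> b \<in> S \<Longrightarrow> a + b \<in> S"
  using subring_diff[of a "- b"] subring_uminus by simp

lemma subring_of_nat: "of_nat k \<in> S"
  by (induction k) (auto intro: subring_zero subring_one subring_add)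

lemma subring_power: "a \<in> S \<Longrightarrow> a ^ k \<in> S"
  by (induction k) (auto intro: subring_one subring_mult)

lemma subring_sum: "(\<And>i. i \<in> A \<Longrightarrow> f i \<in> S) \<Longrightarrow> sum f A \<in> S"
  by (induction A rule: infinite_finite_induct) (auto intro: subring_zero subring_add)

lemma subring_prod: "(\<And>i. i \<in> A \<Longrightarrow> f i \<in> S) \<Longrightarrow> prod f A \<in> S"
  by (induction A rule: infinite_finite_induct) (auto intro: subring_one subring_mult)

lemma subring_poly: "\<forall>i. coeff p i \<in> S \<Longrightarrow> x \<in> S \<Longrightarrow> poly p x \<in> S"
  unfolding poly_altdef by (auto intro!: subring_sum subring_mult subring_power)

lemma subring_coeff_mult:
  assumes "\<forall>i. coeff p i \<in> S" "\<forall>i. coeff q i \<in> S"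
  shows "\<forall>i. coeff (p * q) i \<in> S"
  using assms by (auto simp: coeff_mult intro!: subring_sum subring_mult)

end

lemmas subring_intros = subring_zero subring_one subring_add subring_diff subring_mult
  subring_uminus subring_power subring_sum subring_prod subring_of_nat

lemma all_coeff_pCons: "(\<forall>i. coeff (pCons a p) i \<in> S) \<longleftrightarrow> a \<in> S \<and> (\<forall>i. coeff p i \<in> S)"
  by (metis coeff_pCons_0 coeff_pCons_Suc not0_implies_Suc)

text \<open>The ring \<open>B[x]\<close>. Presenting its elements by polynomials over
  \<open>B\<close> is what allows a derivation of \<open>B\<close> to be extended
  coefficientwise.\<close>

definition adjoin :: "'a::comm_ring_1 set \<Rightarrow> 'a \<Rightarrow> 'a set" where
  "adjoin B x = {poly p x | p. \<forall>i. coeff p i \<in> B}"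

lemma adjoin_subring:
  assumes "is_subring B" shows "is_subring (adjoin B x)"
  unfolding is_subring_def
proof (intro conjI ballI)
  show "1 \<in> adjoin B x"
    unfolding adjoin_def using subring_one[OF assms] subring_zero[OF assms]
    by (auto intro!: exI[of _ "1 :: 'a poly"] simp: coeff_1)
next
  fix a b assume "a \<in> adjoin B x" "b \<in> adjoin B x"
  then obtain p q where p: "a = poly p x" "\<forall>i. coeff p i \<in> B" and q: "b = poly q x" "\<forall>i. coeff q i \<in> B"
    by (auto simp: adjoin_def)
  show "a - b \<in> adjoin B x"
    unfolding adjoin_def using p q subring_diff[OF assms] by (auto intro!: exI[of _ "p - q"])
  show "a * b \<in> adjoin B x"
    unfolding adjoin_def using p q subring_coeff_mult[OF assms p(2) q(2)] by (auto intro!: exI[of _ "p * q"])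
qed

lemma adjoin_base: "is_subring B \<Longrightarrow> B \<subseteq> adjoin B x"
proof
  fix a assume "is_subring B" "a \<in> B"
  then show "a \<in> adjoin B x"
    unfolding adjoin_def
    by (intro CollectI exI[of _ "[:a:]"]) (simp add: all_coeff_pCons subring_zero)
qed

lemma adjoin_elem: "is_subring B \<Longrightarrow> x \<in> adjoin B x"
  unfolding adjoin_def
  by (rule CollectI, rule exI[of _ "[:0, 1:]"]) (simp add: all_coeff_pCons subring_zero subring_one)

definition subring_gen :: "'a::comm_ring_1 set \<Rightarrow> 'a set \<Rightarrow> 'a set" where
  "subring_gen K S = \<Inter>{B. is_subring B \<and> K \<union> S \<subseteq> B}"

lemma subring_gen_subring: "is_subring (subring_gen K S)"
  unfolding subring_gen_def by (auto simp: is_subring_def)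

lemma subring_gen_base: "K \<union> S \<subseteq> subring_gen K S"
  unfolding subring_gen_def by auto

lemma subring_gen_least: "is_subring B \<Longrightarrow> K \<subseteq> B \<Longrightarrow> S \<subseteq> B \<Longrightarrow> subring_gen K S \<subseteq> B"
  unfolding subring_gen_def by auto

lemma subring_gen_mono: "S \<subseteq> T \<Longrightarrow> subring_gen K S \<subseteq> subring_gen K T"
  unfolding subring_gen_def by blast

lemma subring_gen_empty: "is_subring K \<Longrightarrow> subring_gen K {} = K"
  using subring_gen_least[of K K "{}"] subring_gen_base[of K "{}"] by auto

text \<open>Makes induction over finitely many generators possible: each new generator is one simple
  extension.\<close>

lemma subring_gen_insert: "subring_gen K (insert x S) = adjoin (subring_gen K S) x"
proof
  show "subring_gen K (insert x S) \<subseteq> adjoin (subring_gen K S) x"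
    using subring_gen_base[of K S] adjoin_base[OF subring_gen_subring, of K S x]
    by (intro subring_gen_least adjoin_subring subring_gen_subring) (auto intro: adjoin_elem subring_gen_subring)
  show "adjoin (subring_gen K S) x \<subseteq> subring_gen K (insert x S)"
    using subring_gen_mono[of S "insert x S" K] subring_gen_base[of K "insert x S"]
    by (auto simp: adjoin_def intro!: subring_poly subring_gen_subring)
qed

section \<open>Derivations modulo a prime\<close>

text \<open>\<open>K\<close> plays the role of the ground field and \<open>R\<close> that of a
  finitely generated \<open>K\<close>-algebra. Finiteness of \<open>G\<close> allows derivations to
  be extended to all of \<open>R\<close> generator by generator.\<close>

locale affine_ring =
  fixes K R G :: "ratfn set"
  assumes subring_K: "is_subring K"
    and inverse_K: "c \<in> K \<Longrightarrow> inverse c \<in> K"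
    and subring_R: "is_subring R"
    and fin_G: "finite G"
    and subring_gen_G: "subring_gen K G = R"

text \<open>Elements of the quotient field of \<open>R/Q\<close> are never formed: all computations take place
  in \<open>R\<close> modulo \<open>Q\<close>.\<close>

locale affine_prime = affine_ring +
  fixes Q :: "ratfn set"
  assumes prime: "prime_in R Q"
begin

lemma K_R: "K \<subseteq> R" and G_R: "G \<subseteq> R"
  using subring_gen_base subring_gen_G by auto

lemma Q_R: "Q \<subseteq> R" "a \<in> Q \<Longrightarrow> a \<in> R"
  and Q_zero: "0 \<in> Q" and Q_add: "a \<in> Q \<Longrightarrow> b \<in> Q \<Longrightarrow> a + b \<in> Q"
  and Q_mult: "r \<in> R \<Longrightarrow> a \<in> Q \<Longrightarrow> r * a \<in> Q"
  and Q_cancel: "a * b \<in> Q \<Longrightarrow> a \<in> R \<Longrightarrow> b \<in> R \<Longrightarrow> a \<notin> Q \<Longrightarrow> b \<in> Q"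
  using prime by (auto simp: prime_in_def ideal_in_def)

lemma Q_mult2: "r \<in> R \<Longrightarrow> a \<in> Q \<Longrightarrow> a * r \<in> Q"
  by (metis Q_mult mult.commute)

lemma Q_uminus: "a \<in> Q \<Longrightarrow> - a \<in> Q"
  using Q_mult[of "- 1" a] subring_uminus[OF subring_R subring_one[OF subring_R]] by simp

lemma Q_diff: "a \<in> Q \<Longrightarrow> b \<in> Q \<Longrightarrow> a - b \<in> Q"
  using Q_add[of a "- b"] Q_uminus by simp

lemma Q_iff: "a - b \<in> Q \<Longrightarrow> a \<in> Q \<longleftrightarrow> b \<in> Q"
  using Q_add[of "a - b" b] Q_diff[of a "a - b"] by auto

lemma one_notin_Q: "1 \<notin> Q"
  using prime Q_mult[of _ 1] by (auto simp: prime_in_def ideal_in_def)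

lemma unit_notin_Q: "m \<in> R \<Longrightarrow> inverse m \<in> R \<Longrightarrow> m \<noteq> 0 \<Longrightarrow> m \<notin> Q"
  using one_notin_Q Q_mult[of "inverse m" m] by auto

lemma K_Q: "c \<in> K \<Longrightarrow> c \<in> Q \<Longrightarrow> c = 0"
  using unit_notin_Q[of c] inverse_K[of c] K_R by auto

lemma of_nat_R: "of_nat k \<in> R"
  by (rule subring_of_nat[OF subring_R])

lemma of_nat_Q: "of_nat k \<in> Q \<Longrightarrow> k = 0"
  using K_Q[OF subring_of_nat[OF subring_K]] by simp

lemma subring_gen_R: "S \<subseteq> R \<Longrightarrow> subring_gen K S \<subseteq> R"
  by (rule subring_gen_least[OF subring_R K_R])

lemma R_closed:
  "a \<in> R \<Longrightarrow> b \<in> R \<Longrightarrow> a + b \<in> R" "a \<in> R \<Longrightarrow> b \<in> R \<Longrightarrow> a - b \<in> R"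
  "a \<in> R \<Longrightarrow> b \<in> R \<Longrightarrow> a * b \<in> R" "a \<in> R \<Longrightarrow> - a \<in> R" "a \<in> R \<Longrightarrow> a ^ k \<in> R"
  "0 \<in> R" "1 \<in> R"
  using subring_intros[OF subring_R] by auto

text \<open>\<open>deriv_mod\<close> is a derivation from \<open>B\<close> to \<open>R/Q\<close>; \<open>deriv_quot\<close> is one that factors through
  \<open>B/(Q \<inter> B)\<close>.\<close>

definition deriv_mod :: "ratfn set \<Rightarrow> (ratfn \<Rightarrow> ratfn) \<Rightarrow> bool" where
  "deriv_mod B D \<longleftrightarrow> (\<forall>a\<in>B. D a \<in> R) \<and>
     (\<forall>a\<in>B. \<forall>b\<in>B. D (a + b) - (D a + D b) \<in> Q \<and> D (a * b) - (a * D b + b * D a) \<in> Q) \<and>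
     (\<forall>c\<in>K. D c \<in> Q)"

definition deriv_quot :: "ratfn set \<Rightarrow> (ratfn \<Rightarrow> ratfn) \<Rightarrow> bool" where
  "deriv_quot B D \<longleftrightarrow> deriv_mod B D \<and> (\<forall>a\<in>B. a \<in> Q \<longrightarrow> D a \<in> Q)"

lemma deriv_modD:
  assumes "deriv_mod B D"
  shows "a \<in> B \<Longrightarrow> D a \<in> R"
    and "a \<in> B \<Longrightarrow> b \<in> B \<Longrightarrow> D (a + b) - (D a + D b) \<in> Q"
    and "a \<in> B \<Longrightarrow> b \<in> B \<Longrightarrow> D (a * b) - (a * D b + b * D a) \<in> Q"
    and "c \<in> K \<Longrightarrow> D c \<in> Q"
  using assms by (auto simp: deriv_mod_def)

lemma deriv_quotD:
  assumes "deriv_quot B D"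
  shows "a \<in> B \<Longrightarrow> D a \<in> R"
    and "a \<in> B \<Longrightarrow> b \<in> B \<Longrightarrow> D (a + b) - (D a + D b) \<in> Q"
    and "a \<in> B \<Longrightarrow> b \<in> B \<Longrightarrow> D (a * b) - (a * D b + b * D a) \<in> Q"
    and "a \<in> B \<Longrightarrow> a \<in> Q \<Longrightarrow> D a \<in> Q"
    and "c \<in> K \<Longrightarrow> D c \<in> Q"
  using assms by (auto simp: deriv_quot_def deriv_mod_def)

lemma deriv_mod_scale:
  assumes D: "deriv_mod B D" and "u \<in> R" "B \<subseteq> R"
  shows "deriv_mod B (\<lambda>a. u * D a)"
  unfolding deriv_mod_def
proof (intro conjI ballI impI)
  fix a b assume ab: "a \<in> B" "b \<in> B"
  show "u * D (a + b) - (u * D a + u * D b) \<in> Q"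
    using Q_mult[OF assms(2) deriv_modD(2)[OF D ab]] by (simp add: algebra_simps)
  show "u * D (a * b) - (a * (u * D b) + b * (u * D a)) \<in> Q"
    using Q_mult[OF assms(2) deriv_modD(3)[OF D ab]] by (simp add: algebra_simps)
qed (use assms deriv_modD[OF D] in \<open>auto intro: R_closed Q_mult\<close>)

lemma deriv_mod_add:
  assumes D: "deriv_mod B D" and E: "deriv_mod B E"
  shows "deriv_mod B (\<lambda>c. D c + E c)"
  unfolding deriv_mod_def
proof (intro conjI ballI impI)
  fix x y assume xy: "x \<in> B" "y \<in> B"
  from Q_add[OF deriv_modD(2)[OF D this] deriv_modD(2)[OF E this]]
  show "D (x + y) + E (x + y) - (D x + E x + (D y + E y)) \<in> Q" by (simp add: algebra_simps)
  from Q_add[OF deriv_modD(3)[OF D xy] deriv_modD(3)[OF E xy]]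
  show "D (x * y) + E (x * y) - (x * (D y + E y) + y * (D x + E x)) \<in> Q" by (simp add: algebra_simps)
qed (use deriv_modD[OF D] deriv_modD[OF E] in \<open>auto intro: R_closed Q_add\<close>)

lemma deriv_quot_scale: "deriv_quot B D \<Longrightarrow> u \<in> R \<Longrightarrow> B \<subseteq> R \<Longrightarrow> deriv_quot B (\<lambda>a. u * D a)"
  unfolding deriv_quot_def by (auto intro: deriv_mod_scale Q_mult)

lemma deriv_quot_add: "deriv_quot B D \<Longrightarrow> deriv_quot B E \<Longrightarrow> deriv_quot B (\<lambda>c. D c + E c)"
  unfolding deriv_quot_def by (auto intro: deriv_mod_add Q_add)

text \<open>The value at \<open>p(x)\<close> of the would-be extension of \<open>D\<close> to \<open>B[x]\<close> that sends \<open>x\<close> to \<open>e\<close>. The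
  case distinction makes coefficients beyond the degree harmless, as \<open>D 0\<close> is only \<open>0\<close> modulo \<open>Q\<close>.\<close>

definition poly_lift :: "(ratfn \<Rightarrow> ratfn) \<Rightarrow> ratfn \<Rightarrow> ratfn \<Rightarrow> ratfn poly \<Rightarrow> ratfn" where
  "poly_lift D e x p = poly (map_poly (\<lambda>c. if c = 0 then 0 else D c) p) x + e * poly (pderiv p) x"

lemma poly_lift_0 [simp]: "poly_lift D e x 0 = 0"
  by (simp add: poly_lift_def)

lemma poly_lift_pCons: "poly_lift D e x (pCons a p) = (if a = 0 then 0 else D a) + x * poly_lift D e x p + e * poly p x"
  by (simp add: poly_lift_def map_poly_pCons pderiv_pCons algebra_simps)

context
  fixes B D x e
  assumes B: "is_subring B" "K \<subseteq> B" "B \<subseteq> R" and D: "deriv_quot B D" and x: "x \<in> R" and e: "e \<in> R"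
begin

lemma poly_lift_pCons_cong:
  "a \<in> B \<Longrightarrow> poly_lift D e x (pCons a p) - (D a + x * poly_lift D e x p + e * poly p x) \<in> Q"
  using Q_uminus[OF deriv_quotD(5)[OF D subring_zero[OF subring_K]]] by (simp add: poly_lift_pCons Q_zero)

lemma poly_R: "\<forall>i. coeff p i \<in> B \<Longrightarrow> poly p x \<in> R"
  using B x by (intro subring_poly subring_R) auto

lemma poly_lift_R: "\<forall>i. coeff p i \<in> B \<Longrightarrow> poly_lift D e x p \<in> R"
proof (induction p)
  case (pCons a p)
  then show ?case using poly_R[of p] deriv_quotD(1)[OF D, of a] x e
    by (auto simp: poly_lift_pCons all_coeff_pCons intro!: R_closed)
qed (simp add: R_closed)

lemma poly_lift_add:
  "\<forall>i. coeff p i \<in> B \<Longrightarrow> \<forall>i. coeff q i \<in> B \<Longrightarrow> poly_lift D e x (p + q) - (poly_lift D e x p + poly_lift D e x q) \<in> Q"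
proof (induction p q rule: poly_induct2)
  case (pCons a p b q)
  have c: "a \<in> B" "b \<in> B" "\<forall>i. coeff p i \<in> B" "\<forall>i. coeff q i \<in> B"
    using pCons.prems by (auto simp: all_coeff_pCons)
  have ab: "a + b \<in> B" using subring_add[OF B(1)] c by auto
  have "x * (poly_lift D e x (p + q) - (poly_lift D e x p + poly_lift D e x q)) \<in> Q"
    using pCons.IH c x by (intro Q_mult) auto
  from Q_add[OF Q_add[OF this deriv_quotD(2)[OF D c(1,2)]] Q_diff[OF Q_diff[OF poly_lift_pCons_cong[OF ab, of "p + q"]
      poly_lift_pCons_cong[OF c(1), of p]] poly_lift_pCons_cong[OF c(2), of q]]]
  show ?case by (simp add: algebra_simps)
qed (simp add: Q_zero)

lemma poly_lift_smult:
  "a \<in> B \<Longrightarrow> \<forall>i. coeff p i \<in> B \<Longrightarrow> poly_lift D e x (smult a p) - (a * poly_lift D e x p + poly p x * D a) \<in> Q"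
proof (induction p)
  case (pCons b p)
  have c: "a \<in> B" "b \<in> B" "\<forall>i. coeff p i \<in> B" using pCons.prems by (auto simp: all_coeff_pCons)
  have ab: "a * b \<in> B" using subring_mult[OF B(1)] c by auto
  have 1: "x * (poly_lift D e x (smult a p) - (a * poly_lift D e x p + poly p x * D a)) \<in> Q"
    using pCons.IH c x by (intro Q_mult) auto
  have 2: "a * (poly_lift D e x (pCons b p) - (D b + x * poly_lift D e x p + e * poly p x)) \<in> Q"
    using c B by (intro Q_mult poly_lift_pCons_cong) auto
  from Q_add[OF Q_add[OF 1 deriv_quotD(3)[OF D c(1,2)]] Q_diff[OF poly_lift_pCons_cong[OF ab, of "smult a p"] 2]]
  show ?case by (simp add: algebra_simps)
qed (simp add: Q_zero)

text \<open>The Leibniz rule on the level of polynomials. Splitting off the constant coefficient of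
  \<open>p\<close> reduces it to the rules for sums and for multiples by an element of
  \<open>B\<close>.\<close>

lemma poly_lift_mult:
  "\<forall>i. coeff p i \<in> B \<Longrightarrow> \<forall>i. coeff q i \<in> B \<Longrightarrow>
   poly_lift D e x (p * q) - (poly p x * poly_lift D e x q + poly q x * poly_lift D e x p) \<in> Q"
proof (induction p)
  case (pCons a p)
  have c: "a \<in> B" "\<forall>i. coeff q i \<in> B" "\<forall>i. coeff p i \<in> B" using pCons.prems by (auto simp: all_coeff_pCons)
  have pq: "\<forall>i. coeff (p * q) i \<in> B" by (rule subring_coeff_mult[OF B(1) c(3,2)])
  have z: "0 \<in> B" by (rule subring_zero[OF B(1)])
  have "\<forall>i. coeff (smult a q) i \<in> B" "\<forall>i. coeff (pCons 0 (p * q)) i \<in> B"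
    using subring_mult[OF B(1)] c pq z by (auto simp: all_coeff_pCons)
  note 0 = poly_lift_add[OF this]
  note 1 = poly_lift_smult[OF c(1,2)]
  have 2: "x * (poly_lift D e x (p * q) - (poly p x * poly_lift D e x q + poly q x * poly_lift D e x p)) \<in> Q"
    using pCons.IH c x by (intro Q_mult) auto
  have 3: "poly q x * (poly_lift D e x (pCons a p) - (D a + x * poly_lift D e x p + e * poly p x)) \<in> Q"
    using c poly_R by (intro Q_mult poly_lift_pCons_cong) auto
  have 4: "poly_lift D e x (pCons 0 (p * q)) = x * poly_lift D e x (p * q) + e * (poly p x * poly q x)"
    by (simp add: poly_lift_pCons)
  from Q_diff[OF Q_add[OF Q_add[OF 0 1] 2] 3]
  show ?case by (simp add: 4 algebra_simps)
qed (simp add: Q_zero)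

text \<open>Relations with all coefficients in \<open>Q\<close> put no condition on
  \<open>e\<close>. Over an \<open>x\<close> that is transcendental modulo \<open>Q\<close> there
  are no other relations, so every \<open>e\<close> is admissible there.\<close>

lemma poly_lift_Q: "\<forall>i. coeff p i \<in> B \<Longrightarrow> \<forall>i. coeff p i \<in> Q \<Longrightarrow> poly_lift D e x p \<in> Q \<and> poly p x \<in> Q"
proof (induction p)
  case (pCons a p)
  have c: "a \<in> B" "a \<in> Q" "\<forall>i. coeff p i \<in> B" "\<forall>i. coeff p i \<in> Q"
    using pCons.prems by (auto simp: all_coeff_pCons)
  show ?case
    using pCons.IH c x e deriv_quotD(4)[OF D c(1,2)] by (auto simp: poly_lift_pCons intro!: Q_add Q_mult)
qed (simp add: Q_zero)

text \<open>Two polynomials representing the same element differ by one that vanishes at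
  \<open>x\<close>. Its lift lies in \<open>Q\<close> by \<open>W\<close>, so the value at a chosen
  representative is well defined modulo \<open>Q\<close>. The same assumption makes the extension
  map elements of \<open>Q\<close> into \<open>Q\<close>.\<close>

lemma deriv_quot_adjoin:
  assumes W: "\<And>p. \<forall>i. coeff p i \<in> B \<Longrightarrow> poly p x \<in> Q \<Longrightarrow> poly_lift D e x p \<in> Q"
  obtains D' where "deriv_quot (adjoin B x) D'" "\<And>a. a \<in> B \<Longrightarrow> D' a - D a \<in> Q" "D' x - e \<in> Q"
proof -
  define D' where "D' a = poly_lift D e x (SOME p. (\<forall>i. coeff p i \<in> B) \<and> poly p x = a)" for a
  have key: "D' a - poly_lift D e x p \<in> Q" if "\<forall>i. coeff p i \<in> B" "poly p x = a" for p a
  proof -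
    define q where "q = (SOME p. (\<forall>i. coeff p i \<in> B) \<and> poly p x = a)"
    have q: "(\<forall>i. coeff q i \<in> B) \<and> poly q x = a"
      unfolding q_def by (rule someI[of _ p]) (use that in auto)
    have qp: "\<forall>i. coeff (q - p) i \<in> B" using q that subring_diff[OF B(1)] by auto
    have w: "poly_lift D e x (q - p) \<in> Q"
      using q that by (intro W qp) (auto simp: Q_zero)
    from Q_diff[OF w Q_uminus[OF poly_lift_add[OF qp that(1)]]] Q_diff[OF _ w]
    have "poly_lift D e x q - poly_lift D e x p \<in> Q" by fastforce
    then show ?thesis by (simp add: D'_def q_def)
  qed
  have rep: "\<exists>p. (\<forall>i. coeff p i \<in> B) \<and> poly p x = a" if "a \<in> adjoin B x" for a
    using that by (auto simp: adjoin_def)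
  have AR: "adjoin B x \<subseteq> R" using poly_R by (auto simp: adjoin_def)
  have z: "0 \<in> B" "1 \<in> B" using subring_zero[OF B(1)] subring_one[OF B(1)] by auto
  have restr: "D' a - D a \<in> Q" if "a \<in> B" for a
  proof -
    have "D' a - poly_lift D e x [:a:] \<in> Q" by (rule key) (use that z in \<open>auto simp: all_coeff_pCons\<close>)
    from Q_add[OF this poly_lift_pCons_cong[OF that, of 0]] show ?thesis by simp
  qed
  have "deriv_quot (adjoin B x) D'"
    unfolding deriv_quot_def deriv_mod_def
  proof (intro conjI ballI impI)
    fix a assume a: "a \<in> adjoin B x"
    then obtain p where p: "\<forall>i. coeff p i \<in> B" "poly p x = a" using rep by blast
    show "D' a \<in> R"
      using R_closed(1)[OF Q_R(2)[OF key[OF p]] poly_lift_R[OF p(1)]] by simp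
    show "D' a \<in> Q" if "a \<in> Q"
      using Q_iff[OF key[OF p]] W[OF p(1)] p(2) that by simp
    fix b assume "b \<in> adjoin B x"
    then obtain q where q: "\<forall>i. coeff q i \<in> B" "poly q x = b" using rep by blast
    have "\<forall>i. coeff (p + q) i \<in> B" using p q subring_add[OF B(1)] by auto
    then have "D' (a + b) - poly_lift D e x (p + q) \<in> Q" by (rule key) (use p q in simp)
    from Q_diff[OF Q_diff[OF Q_add[OF this poly_lift_add[OF p(1) q(1)]] key[OF p]] key[OF q]]
    show "D' (a + b) - (D' a + D' b) \<in> Q" by (simp add: algebra_simps)
    have "D' (a * b) - poly_lift D e x (p * q) \<in> Q"
      by (rule key[OF subring_coeff_mult[OF B(1) p(1) q(1)]]) (use p q in simp)
    note 1 = Q_add[OF this poly_lift_mult[OF p(1) q(1)]]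
    have "a * (D' b - poly_lift D e x q) \<in> Q" "b * (D' a - poly_lift D e x p) \<in> Q"
      using key[OF p] key[OF q] AR a \<open>b \<in> adjoin B x\<close> by (auto intro!: Q_mult)
    from Q_diff[OF Q_diff[OF 1 this(1)] this(2)] show "D' (a * b) - (a * D' b + b * D' a) \<in> Q"
      by (simp add: p q algebra_simps)
  next
    fix c assume "c \<in> K"
    then show "D' c \<in> Q" using Q_iff[OF restr] deriv_quotD(5)[OF D] B by blast
  qed
  moreover have "D' x - e \<in> Q"
  proof -
    have D1: "D 1 \<in> Q" "D 0 \<in> Q" using deriv_quotD(5)[OF D] subring_one[OF subring_K] subring_zero[OF subring_K] by auto
    have "D' x - poly_lift D e x [:0, 1:] \<in> Q" by (rule key) (use z in \<open>auto simp: all_coeff_pCons\<close>)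
    moreover have "poly_lift D e x [:0, 1:] - e \<in> Q" using Q_mult[OF x D1(1)] by (simp add: poly_lift_pCons)
    ultimately show ?thesis using Q_add by fastforce
  qed
  ultimately show ?thesis using that restr by blast
qed

end

text \<open>The class of \<open>x\<close> in \<open>R/Q\<close> is transcendental over the image of
  \<open>B\<close>. A polynomial over that image is zero exactly if all coefficients of a
  representative lie in \<open>Q\<close>.\<close>

definition trans_over :: "ratfn set \<Rightarrow> ratfn \<Rightarrow> bool" where
  "trans_over B x \<longleftrightarrow> (\<forall>p. (\<forall>i. coeff p i \<in> B) \<longrightarrow> poly p x \<in> Q \<longrightarrow> (\<forall>i. coeff p i \<in> Q))"

end

section \<open>Algebraic relations and the extension of derivations\<close>

context affine_prime begin

text \<open>Take a relation of least degree among those that are nontrivial modulo \<open>Q\<close>.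
  Its derivative has smaller degree and is still nontrivial in characteristic 0, so by minimality it
  cannot vanish at \<open>x\<close> modulo \<open>Q\<close>: the relation is separable.\<close>

lemma minimal_relation:
  assumes B: "is_subring B" "B \<subseteq> R" and x: "x \<in> R" and nt: "\<not> trans_over B x"
  obtains f where "\<forall>i. coeff f i \<in> B" "poly f x \<in> Q" "lead_coeff f \<notin> Q" "poly (pderiv f) x \<notin> Q"
    "\<And>p. \<forall>i. coeff p i \<in> B \<Longrightarrow> poly p x \<in> Q \<Longrightarrow> degree p < degree f \<Longrightarrow> \<forall>i. coeff p i \<in> Q"
proof -
  define P where "P p \<longleftrightarrow> (\<forall>i. coeff p i \<in> B) \<and> poly p x \<in> Q \<and> \<not> (\<forall>i. coeff p i \<in> Q)" for p
  obtain p0 where "P p0" using nt by (auto simp: trans_over_def P_def)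
  then obtain f where f: "P f" and min: "\<And>p. P p \<Longrightarrow> degree f \<le> degree p"
    using ex_has_least_nat[of P p0 degree] by blast
  have min': "\<forall>i. coeff p i \<in> Q"
    if "\<forall>i. coeff p i \<in> B" "poly p x \<in> Q" "degree p < degree f" for p
    using min[of p] that by (auto simp: P_def)
  have lc: "lead_coeff f \<notin> Q"
  proof
    assume lc: "lead_coeff f \<in> Q"
    \<comment> \<open>With the leading coefficient in \<open>Q\<close>, dropping the leading term
      leaves a relation of smaller degree, hence a trivial one; then \<open>f\<close> would be
      trivial too.\<close>
    define g where "g = f - monom (lead_coeff f) (degree f)"
    have g1: "\<forall>i. coeff g i \<in> B"
      using f subring_diff[OF B(1)] subring_zero[OF B(1)] by (auto simp: g_def P_def)
    have "lead_coeff f * x ^ degree f \<in> Q" by (intro Q_mult2 lc R_closed x)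
    then have g2: "poly g x \<in> Q" using f by (auto simp: g_def P_def poly_monom intro: Q_diff)
    have "\<forall>i. coeff g i \<in> Q"
    proof (cases "degree f = 0")
      case True
      then show ?thesis by (auto simp: g_def Q_zero monom_0 coeff_pCons coeff_eq_0 split: nat.splits)
    next
      case False
      have "g = 0 \<or> degree g < degree f"
        by (intro eq_zero_or_degree_less) (auto simp: g_def intro!: degree_diff_le degree_monom_le)
      then show ?thesis using min'[OF g1 g2] by (auto simp: Q_zero)
    qed
    then have "coeff f i \<in> Q" for i
      using lc by (cases "i = degree f") (auto simp: g_def split: if_splits dest: spec[of _ i])
    then show False using f by (simp add: P_def)
  qed
  have deg: "degree f > 0"
  proof (rule ccontr)
    assume "\<not> degree f > 0"
    then obtain c where "f = [:c:]" by (metis degree_eq_zeroE gr0I)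
    then show False using f lc by (simp add: P_def)
  qed
  have "poly (pderiv f) x \<notin> Q"
  proof
    assume a: "poly (pderiv f) x \<in> Q"
    have "\<forall>i. coeff (pderiv f) i \<in> B"
      using f subring_mult[OF B(1)] subring_of_nat[OF B(1)] unfolding P_def coeff_pderiv by blast
    from min'[OF this a] have "coeff (pderiv f) (degree f - 1) \<in> Q" using deg by (simp add: degree_pderiv)
    then have "of_nat (degree f) * lead_coeff f \<in> Q" using deg by (simp add: coeff_pderiv)
    then show False
      using Q_cancel[OF _ of_nat_R, of "degree f" "lead_coeff f"] of_nat_Q[of "degree f"] deg lc f B
      by (auto simp: P_def)
  qed
  then show thesis using that f lc min' by (auto simp: P_def)
qed

text \<open>If \<open>x\<close> satisfies a minimal relation \<open>f(x) \<in> Q\<close>, the extension is forced to send \<open>x\<close> to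
  \<open>- (D f)(x) / f'(x)\<close>; the factor \<open>u = f'(x)\<close> clears this denominator.\<close>

lemma extend_adjoin:
  assumes B: "is_subring B" "K \<subseteq> B" "B \<subseteq> R" and D: "deriv_quot B D" and x: "x \<in> R"
  obtains u D' where "u \<in> R" "u \<notin> Q" "deriv_quot (adjoin B x) D'" "\<And>a. a \<in> B \<Longrightarrow> D' a - u * D a \<in> Q"
proof (cases "trans_over B x")
  case True
  have "poly_lift D 0 x p \<in> Q" if "\<forall>i. coeff p i \<in> B" "poly p x \<in> Q" for p
    using poly_lift_Q[OF B D x, of 0 p] that True by (auto simp: trans_over_def R_closed)
  from deriv_quot_adjoin[OF B D x _ this] that[of 1] show thesis
    using R_closed(6,7) one_notin_Q by (metis mult_1)
next
  case False
  obtain f where f: "\<forall>i. coeff f i \<in> B" "poly f x \<in> Q" "lead_coeff f \<notin> Q" "poly (pderiv f) x \<notin> Q"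
    and min: "\<And>p. \<forall>i. coeff p i \<in> B \<Longrightarrow> poly p x \<in> Q \<Longrightarrow> degree p < degree f \<Longrightarrow> \<forall>i. coeff p i \<in> Q"
    using minimal_relation[OF B(1,3) x False] by metis
  define u where "u = poly (pderiv f) x"
  define e where "e = - poly (map_poly (\<lambda>c. if c = 0 then 0 else D c) f) x"
  have f': "\<forall>i. coeff (pderiv f) i \<in> B"
    using f(1) subring_mult[OF B(1)] subring_of_nat[OF B(1)] unfolding coeff_pderiv by blast
  have uR: "u \<in> R" unfolding u_def by (rule poly_R[OF B D x R_closed(6) f'])
  have "poly (map_poly (\<lambda>c. if c = 0 then 0 else D c) f) x = poly_lift D 0 x f" by (simp add: poly_lift_def)
  then have eR: "e \<in> R" unfolding e_def using poly_lift_R[OF B D x R_closed(6) f(1)] by (auto intro: R_closed)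
  define D1 where "D1 = (\<lambda>a. u * D a)"
  have D1: "deriv_quot B D1" unfolding D1_def by (rule deriv_quot_scale[OF D uR B(3)])
  have "map_poly (\<lambda>c. if c = 0 then 0 else D1 c) f = smult u (map_poly (\<lambda>c. if c = 0 then 0 else D c) f)"
    by (rule poly_eqI) (simp add: coeff_map_poly D1_def)
  \<comment> \<open>The scaling by \<open>u = f'(x)\<close> and the choice of \<open>e\<close>
    cancel each other in the lift of \<open>f\<close>:
    \<open>u * (D f)(x) + e * f'(x) = 0\<close>.\<close>
  then have pdf: "poly_lift D1 e x f = 0" by (simp add: poly_lift_def e_def u_def)
  note ctx = B D1 x eR
  have W: "poly_lift D1 e x p \<in> Q" if "\<forall>i. coeff p i \<in> B" "poly p x \<in> Q" for p
    using that
  proof (induction "degree p" arbitrary: p rule: less_induct)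
    case less
    note p = less.prems
    show ?case
    proof (cases "degree p < degree f")
      case True
      then show ?thesis using poly_lift_Q[OF ctx p(1)] min[OF p] by auto
    next
      case False
      \<comment> \<open>Pseudo-division by \<open>f\<close>: multiplying \<open>p\<close> by the
        leading coefficient \<open>a\<close> avoids division in \<open>B\<close>, and
        \<open>a\<close> can be cancelled at the end because it lies outside
        \<open>Q\<close>.\<close>
      define a where "a = lead_coeff f"
      define g where "g = monom (lead_coeff p) (degree p - degree f)"
      define p2 where "p2 = smult a p - g * f"
      have aB: "a \<in> B" using f by (simp add: a_def)
      have gB: "\<forall>i. coeff g i \<in> B" using p subring_zero[OF B(1)] by (auto simp: g_def)
      have gfB: "\<forall>i. coeff (g * f) i \<in> B" by (rule subring_coeff_mult[OF B(1) gB f(1)])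
      have p2B: "\<forall>i. coeff p2 i \<in> B"
        using gfB aB p(1) subring_diff[OF B(1)] subring_mult[OF B(1)] by (auto simp: p2_def)
      have aR: "a \<in> R" and gR: "poly g x \<in> R" using aB B poly_R[OF ctx gB] by auto
      have p2Q: "poly p2 x \<in> Q"
        unfolding p2_def using p(2) f(2) aR gR by (auto intro!: Q_diff Q_mult)
      have "p2 = 0 \<or> degree p2 < degree p"
      proof (rule eq_zero_or_degree_less)
        have "degree (g * f) \<le> degree p"
          using degree_mult_le[of g f] degree_monom_le[of "lead_coeff p" "degree p - degree f"] False
          by (simp add: g_def)
        then show "degree p2 \<le> degree p"
          unfolding p2_def by (intro degree_diff_le) auto
        show "coeff p2 (degree p) = 0"
          using False by (simp add: p2_def g_def a_def coeff_monom_mult)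
      qed
      then have "poly_lift D1 e x p2 \<in> Q"
        using less.hyps[OF _ p2B p2Q] by (auto simp: Q_zero)
      moreover have "poly_lift D1 e x (g * f) \<in> Q"
      proof -
        have "poly f x * poly_lift D1 e x g \<in> Q" using f(2) poly_lift_R[OF ctx gB] by (rule Q_mult2[rotated])
        then show ?thesis using Q_add[OF poly_lift_mult[OF ctx gB f(1)], of "poly f x * poly_lift D1 e x g"] pdf by simp
      qed
      moreover have "p2 + g * f = smult a p" by (simp add: p2_def)
      ultimately have "poly_lift D1 e x (smult a p) \<in> Q"
        using Q_iff[OF poly_lift_add[OF ctx p2B gfB]] Q_add by simp
      moreover have "poly p x * D1 a \<in> Q" using p(2) deriv_quotD(1)[OF D1 aB] by (rule Q_mult2[rotated])
      ultimately have "a * poly_lift D1 e x p \<in> Q"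
        using Q_iff[OF poly_lift_smult[OF ctx aB p(1)]] Q_diff by fastforce
      then show ?thesis using Q_cancel aR poly_lift_R[OF ctx p(1)] f(3) by (auto simp: a_def)
    qed
  qed
  obtain D' where "deriv_quot (adjoin B x) D'" "\<And>a. a \<in> B \<Longrightarrow> D' a - D1 a \<in> Q"
    using deriv_quot_adjoin[OF ctx W] by blast
  then show thesis using that[of u D'] uR f(4) by (auto simp: u_def D1_def)
qed

text \<open>Every generator may contribute a denominator. Their product \<open>u\<close> stays
  outside \<open>Q\<close> because \<open>Q\<close> is prime, so scaling by \<open>u\<close> does
  not affect whether a value vanishes modulo \<open>Q\<close>.\<close>

lemma extend_finite:
  assumes "finite X" "X \<subseteq> R" and S: "S \<subseteq> R" and D: "deriv_quot (subring_gen K S) D"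
  shows "\<exists>u D'. u \<in> R \<and> u \<notin> Q \<and> deriv_quot (subring_gen K (S \<union> X)) D' \<and> (\<forall>a\<in>subring_gen K S. D' a - u * D a \<in> Q)"
  using assms(1,2)
proof (induction X rule: finite_induct)
  case empty
  have "\<forall>a\<in>subring_gen K S. D a - 1 * D a \<in> Q" by (simp add: Q_zero)
  then show ?case using D R_closed(7) one_notin_Q by (metis Un_empty_right)
next
  case (insert x X)
  then obtain u D' where u: "u \<in> R" "u \<notin> Q" and D': "deriv_quot (subring_gen K (S \<union> X)) D'"
    and r: "\<forall>a\<in>subring_gen K S. D' a - u * D a \<in> Q"
    by auto
  have sub: "subring_gen K (S \<union> X) \<subseteq> R" using insert.prems S by (intro subring_gen_R) auto
  have "x \<in> R" "K \<subseteq> subring_gen K (S \<union> X)" using insert.prems subring_gen_base by auto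
  from extend_adjoin[OF subring_gen_subring this(2) sub D' this(1)] obtain w D''
    where w: "w \<in> R" "w \<notin> Q" and D'': "deriv_quot (adjoin (subring_gen K (S \<union> X)) x) D''"
      and r': "\<And>a. a \<in> subring_gen K (S \<union> X) \<Longrightarrow> D'' a - w * D' a \<in> Q" by blast
  have "D'' a - (w * u) * D a \<in> Q" if "a \<in> subring_gen K S" for a
  proof -
    have "a \<in> subring_gen K (S \<union> X)" using that subring_gen_mono[of S "S \<union> X" K] by auto
    from Q_add[OF r'[OF this] Q_mult[OF w(1) r[rule_format, OF that]]]
    show ?thesis by (simp add: algebra_simps)
  qed
  moreover have "w * u \<in> R" "w * u \<notin> Q" using u w Q_cancel[of w u] by (auto intro: R_closed)
  ultimately show ?case using D'' by (auto simp: subring_gen_insert)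
qed

text \<open>The zero derivation on \<open>K[S]\<close> extends to \<open>K[S, x]\<close> with
  \<open>x\<close> sent to 1, as transcendence leaves this value free. Adding the generators
  \<open>G\<close> extends it to \<open>R\<close> up to a factor outside \<open>Q\<close>.\<close>

lemma trans_over_derivation:
  assumes S: "S \<subseteq> R" and x: "x \<in> R" and t: "trans_over (subring_gen K S) x"
  obtains D where "deriv_quot R D" "\<And>s. s \<in> S \<Longrightarrow> D s \<in> Q" "D x \<notin> Q"
proof -
  have B: "is_subring (subring_gen K S)" "K \<subseteq> subring_gen K S" "subring_gen K S \<subseteq> R"
    using subring_gen_subring subring_gen_base[of K S] subring_gen_R[OF S] by auto
  have D0: "deriv_quot (subring_gen K S) (\<lambda>_. 0)" by (auto simp: deriv_quot_def deriv_mod_def Q_zero R_closed)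
  have "poly_lift (\<lambda>_. 0) 1 x p \<in> Q" if "\<forall>i. coeff p i \<in> subring_gen K S" "poly p x \<in> Q" for p
    using poly_lift_Q[OF B D0 x, of 1 p] that t by (auto simp: trans_over_def R_closed)
  from deriv_quot_adjoin[OF B D0 x R_closed(7) this] obtain D1 where
    D1: "deriv_quot (adjoin (subring_gen K S) x) D1" "\<And>a. a \<in> subring_gen K S \<Longrightarrow> D1 a \<in> Q" "D1 x - 1 \<in> Q"
    by auto
  have S': "insert x S \<subseteq> R" using S x by auto
  obtain u D where u: "u \<in> R" "u \<notin> Q" and D: "deriv_quot (subring_gen K (insert x S \<union> G)) D"
    and r: "\<forall>a\<in>subring_gen K (insert x S). D a - u * D1 a \<in> Q"
    using extend_finite[OF fin_G G_R S', of D1] D1(1) by (auto simp: subring_gen_insert)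
  have R: "subring_gen K (insert x S \<union> G) = R"
    using subring_gen_R[of "insert x S \<union> G"] S' G_R subring_gen_mono[of G "insert x S \<union> G" K] subring_gen_G by auto
  have "D s \<in> Q" if "s \<in> S" for s
  proof -
    have s: "s \<in> subring_gen K S" "s \<in> subring_gen K (insert x S)" using that subring_gen_base[of K] by blast+
    show ?thesis using Q_iff[OF r[rule_format, OF s(2)]] Q_mult[OF u(1) D1(2)[OF s(1)]] by simp
  qed
  moreover have "D x \<notin> Q"
  proof
    assume "D x \<in> Q"
    moreover have x': "x \<in> subring_gen K (insert x S)" using subring_gen_base[of K "insert x S"] by auto
    ultimately have "u * D1 x \<in> Q" using Q_iff[OF r[rule_format, OF x']] by simp
    moreover have "D1 x \<in> R" using deriv_quotD(1)[OF D1(1)] x' by (simp add: subring_gen_insert)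
    moreover have "D1 x \<notin> Q" using Q_iff[OF D1(3)] one_notin_Q by simp
    ultimately show False using Q_cancel u by blast
  qed
  ultimately show thesis using that D R by metis
qed

lemma deriv_mod_vanish_subring:
  assumes D: "deriv_mod R D"
  shows "is_subring {a \<in> R. D a \<in> Q}"
  unfolding is_subring_def
proof (intro conjI ballI)
  show "1 \<in> {a \<in> R. D a \<in> Q}" using deriv_modD(4)[OF D subring_one[OF subring_K]] R_closed by auto
next
  fix a b assume "a \<in> {a \<in> R. D a \<in> Q}" "b \<in> {a \<in> R. D a \<in> Q}"
  then have ab: "a \<in> R" "b \<in> R" "D a \<in> Q" "D b \<in> Q" by auto
  then have "a - b \<in> R" by (auto intro: R_closed)
  from deriv_modD(2)[OF D this ab(2)] have "D a - (D (a - b) + D b) \<in> Q" by simp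
  from Q_diff[OF Q_diff[OF ab(3) ab(4)] this] have "D (a - b) \<in> Q" by (simp add: algebra_simps)
  then show "a - b \<in> {a \<in> R. D a \<in> Q}" using \<open>a - b \<in> R\<close> by simp
  have "a * D b + b * D a \<in> Q" using ab by (intro Q_add Q_mult)
  then show "a * b \<in> {a \<in> R. D a \<in> Q}" using Q_iff[OF deriv_modD(3)[OF D ab(1,2)]] ab by (auto intro: R_closed)
qed

lemma deriv_mod_vanish_gen:
  assumes D: "deriv_mod R D" and "S \<subseteq> R" "\<And>s. s \<in> S \<Longrightarrow> D s \<in> Q" "a \<in> subring_gen K S"
  shows "D a \<in> Q"
  using subring_gen_least[OF deriv_mod_vanish_subring[OF D], of K S] assms deriv_modD(4)[OF D] K_R by blast

text \<open>The chain rule: a derivation already defined on \<open>R\<close> agrees modulo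
  \<open>Q\<close> with the formal extension determined by its value at \<open>x\<close>.\<close>

lemma deriv_quot_poly:
  assumes D: "deriv_quot R D" and x: "x \<in> R"
  shows "\<forall>i. coeff p i \<in> R \<Longrightarrow> D (poly p x) - poly_lift D (D x) x p \<in> Q"
proof (induction p)
  case 0
  then show ?case using deriv_quotD(5)[OF D subring_zero[OF subring_K]] by simp
next
  case (pCons a p)
  then have a: "a \<in> R" "\<forall>i. coeff p i \<in> R" by (auto simp: all_coeff_pCons)
  have p: "poly p x \<in> R" "x * poly p x \<in> R" using subring_poly[OF subring_R a(2) x] x by (auto intro: R_closed)
  have 1: "x * (D (poly p x) - poly_lift D (D x) x p) \<in> Q" using pCons.IH a x by (intro Q_mult) auto
  have Dx: "D x \<in> R" using deriv_quotD(1)[OF D x] .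
  from Q_diff[OF Q_add[OF Q_add[OF 1 deriv_quotD(2)[OF D a(1) p(2)]] deriv_quotD(3)[OF D x p(1)]]
      poly_lift_pCons_cong[OF subring_R K_R order_refl D x Dx a(1), of p]]
  show ?case by (simp add: algebra_simps)
qed

lemma poly_lift_const:
  assumes "x \<in> R" shows "\<forall>i. D (coeff p i) \<in> Q \<Longrightarrow> poly_lift D e x p - e * poly (pderiv p) x \<in> Q"
proof (induction p)
  case (pCons a p)
  then have "D a \<in> Q" "\<forall>i. D (coeff p i) \<in> Q" by (auto simp: all_coeff_pCons dest: spec[of _ 0] spec[of _ "Suc _"])
  then have "x * (poly_lift D e x p - e * poly (pderiv p) x) \<in> Q" "(if a = 0 then 0 else D a) \<in> Q"
    using pCons.IH assms by (auto intro: Q_mult simp: Q_zero)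
  from Q_add[OF this] show ?case by (simp add: poly_lift_pCons pderiv_pCons algebra_simps)
qed (simp add: Q_zero)

section \<open>Transcendence degree\<close>

text \<open>The elements algebraic over \<open>K[S]\<close> modulo \<open>Q\<close>, as
  \<open>notin_cl_iff_trans\<close> shows. Phrased with derivations, the closure laws are immediate
  and exchange becomes linear algebra.\<close>

definition cl :: "ratfn set \<Rightarrow> ratfn set" where
  "cl S = {a \<in> R. \<forall>D. deriv_quot R D \<longrightarrow> (\<forall>s\<in>S. D s \<in> Q) \<longrightarrow> D a \<in> Q}"

text \<open>A transcendental element is separated from \<open>S\<close> by the derivation built
  above. Conversely, applying \<open>D\<close> to a separable relation \<open>f(a) \<in> Q\<close>
  gives \<open>D a * f'(a) \<in> Q\<close> with \<open>f'(a) \<notin> Q\<close>, which forces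
  \<open>D a \<in> Q\<close>.\<close>

lemma notin_cl_iff_trans:
  assumes S: "S \<subseteq> R" and a: "a \<in> R"
  shows "a \<notin> cl S \<longleftrightarrow> trans_over (subring_gen K S) a"
proof
  assume "trans_over (subring_gen K S) a"
  then obtain D where "deriv_quot R D" "\<And>s. s \<in> S \<Longrightarrow> D s \<in> Q" "D a \<notin> Q"
    using trans_over_derivation[OF S a] by metis
  then show "a \<notin> cl S" by (auto simp: cl_def)
next
  assume "a \<notin> cl S"
  then obtain D where D: "deriv_quot R D" "\<forall>s\<in>S. D s \<in> Q" "D a \<notin> Q" using a by (auto simp: cl_def)
  show "trans_over (subring_gen K S) a"
  proof (rule ccontr)
    assume "\<not> trans_over (subring_gen K S) a"
    then obtain f where f: "\<forall>i. coeff f i \<in> subring_gen K S" "poly f a \<in> Q" "poly (pderiv f) a \<notin> Q"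
      using minimal_relation[OF subring_gen_subring subring_gen_R[OF S] a] by metis
    have fR: "\<forall>i. coeff f i \<in> R" using f subring_gen_R[OF S] by auto
    have "D (poly f a) \<in> Q" using deriv_quotD(4)[OF D(1)] subring_poly[OF subring_R fR a] f(2) by simp
    then have "poly_lift D (D a) a f \<in> Q" using Q_iff[OF deriv_quot_poly[OF D(1) a fR]] by simp
    moreover have "\<forall>i. D (coeff f i) \<in> Q" using deriv_mod_vanish_gen[OF _ S] D(1)[unfolded deriv_quot_def] D(2) f by blast
    ultimately have "D a * poly (pderiv f) a \<in> Q" using Q_iff[OF poly_lift_const[OF a]] by blast
    moreover have "poly (pderiv f) a \<in> R"
      using fR a of_nat_R by (intro subring_poly subring_R) (auto simp: coeff_pderiv intro: R_closed)
    ultimately show False using Q_cancel[of "D a"] f(3) D deriv_quotD(1)[OF D(1) a] by blast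
  qed
qed

lemma cl_R: "cl S \<subseteq> R"
  by (auto simp: cl_def)

lemma cl_mono: "S \<subseteq> T \<Longrightarrow> cl S \<subseteq> cl T"
  unfolding cl_def by blast

lemma cl_extensive: "S \<subseteq> R \<Longrightarrow> S \<subseteq> cl S"
  unfolding cl_def by blast

lemma cl_closed: "S \<subseteq> cl T \<Longrightarrow> cl S \<subseteq> cl T"
  unfolding cl_def by blast

lemma cl_exchange:
  assumes a: "a \<in> R" and b: "b \<in> cl (insert a S)" "b \<notin> cl S"
  shows "a \<in> cl (insert b S)"
  unfolding cl_def
proof (intro CollectI conjI allI impI a)
  fix D assume D: "deriv_quot R D" "\<forall>s\<in>insert b S. D s \<in> Q"
  have bR: "b \<in> R" using b(1) cl_R by auto
  obtain E where E: "deriv_quot R E" "\<forall>s\<in>S. E s \<in> Q" "E b \<notin> Q" using b(2) bR by (auto simp: cl_def)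
  \<comment> \<open>This combination kills \<open>S\<close> and, by construction, also
    \<open>a\<close>; hence it kills \<open>b\<close>. As \<open>D b\<close> already vanishes,
    \<open>D a * E b\<close> lies in \<open>Q\<close>, while \<open>E b\<close> does not.\<close>
  define F where "F c = D a * E c + (- E a) * D c" for c
  have u: "D a \<in> R" "- E a \<in> R" using deriv_quotD(1)[OF D(1) a] deriv_quotD(1)[OF E(1) a] by (auto intro: R_closed)
  have 1: "deriv_quot R (\<lambda>c. D a * E c)" and 2: "deriv_quot R (\<lambda>c. (- E a) * D c)"
    using deriv_quot_scale[OF E(1) u(1)] deriv_quot_scale[OF D(1) u(2)] by auto
  have "deriv_quot R F" unfolding F_def using deriv_quot_add[OF 1 2] .
  moreover have "\<forall>s\<in>insert a S. F s \<in> Q"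
    using D E u by (auto simp: F_def Q_zero intro!: Q_diff Q_mult[of "D a"] Q_mult[of "E a"] deriv_quotD(1)[OF E(1) a])
  ultimately have "F b \<in> Q" using b(1) by (auto simp: cl_def)
  moreover have "(- E a) * D b \<in> Q" using D(2) by (intro Q_mult u) simp
  ultimately have "D a * E b \<in> Q" using Q_diff[of "F b" "(- E a) * D b"] by (simp add: F_def)
  then show "D a \<in> Q" using Q_cancel[of "E b" "D a"] u E deriv_quotD(1)[OF E(1) bR] by (auto simp: mult.commute)
qed

definition indep :: "ratfn set \<Rightarrow> bool" where
  "indep S \<longleftrightarrow> S \<subseteq> R \<and> (\<forall>a\<in>S. a \<notin> cl (S - {a}))"

lemma indep_empty: "indep {}"
  by (simp add: indep_def)

lemma indep_subset: "indep S \<Longrightarrow> T \<subseteq> S \<Longrightarrow> indep T"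
  unfolding indep_def using cl_mono[of "T - {_}" "S - {_}"] by blast

lemma indep_insert:
  assumes S: "indep S" and a: "a \<in> R" "a \<notin> cl S"
  shows "indep (insert a S)"
  unfolding indep_def
proof (intro conjI ballI)
  show "insert a S \<subseteq> R" using S a by (auto simp: indep_def)
  fix b assume b: "b \<in> insert a S"
  have aS: "a \<notin> S" using a cl_extensive[of S] S by (auto simp: indep_def)
  show "b \<notin> cl (insert a S - {b})"
  proof (cases "b = a")
    case True
    then show ?thesis using a aS by simp
  next
    case False
    then have bS: "b \<in> S" and *: "insert a S - {b} = insert a (S - {b})" "insert b (S - {b}) = S" using b by auto
    have "b \<notin> cl (S - {b})" using S bS by (auto simp: indep_def)
    then show ?thesis using cl_exchange[OF a(1), of b "S - {b}"] a(2) * by auto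
  qed
qed

lemma indep_insertD: "indep (insert a S) \<Longrightarrow> a \<notin> S \<Longrightarrow> indep S \<and> a \<in> R \<and> a \<notin> cl S"
  using indep_subset[of "insert a S" S] by (auto simp: indep_def)

text \<open>Exchange argument: an element of \<open>S\<close> outside \<open>T\<close> is replaced
  by an element of \<open>T\<close> without changing the size or the independence of
  \<open>S\<close>, until \<open>S\<close> is contained in \<open>T\<close>.\<close>

lemma steinitz:
  assumes "finite T" "finite S" "T \<subseteq> R" "indep S" "S \<subseteq> cl T"
  shows "card S \<le> card T"
  using assms(2-)
proof (induction "card (S - T)" arbitrary: S)
  case 0
  then have "S \<subseteq> T" by simp
  then show ?case using assms(1) by (rule card_mono[rotated])
next
  case (Suc k)
  then obtain a where a: "a \<in> S" "a \<notin> T" by (metis DiffE card_eq_0_iff ex_in_conv nat.distinct(1))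
  have nin: "a \<notin> cl (S - {a})" using Suc.prems a by (auto simp: indep_def)
  \<comment> \<open>Otherwise the closure of \<open>T\<close>, which contains \<open>a\<close>,
    would lie in the closure of \<open>S - {a}\<close>.\<close>
  then have "\<not> T \<subseteq> cl (S - {a})" using cl_closed[of T "S - {a}"] Suc.prems a by auto
  then obtain t where t: "t \<in> T" "t \<notin> cl (S - {a})" by auto
  have SR: "S - {a} \<subseteq> R" using Suc.prems by (auto simp: indep_def)
  then have tS: "t \<notin> S - {a}" using t cl_extensive by auto
  let ?S = "insert t (S - {a})"
  have "?S - T = S - T - {a}" using t by auto
  then have k: "k = card (?S - T)" using Suc.hyps(2) Suc.prems(1) a by simp
  have "card ?S \<le> card T"
  proof (rule Suc.hyps(1)[OF k])
    show "indep ?S" using t Suc.prems by (intro indep_insert indep_subset[OF Suc.prems(3)]) auto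
    show "?S \<subseteq> cl T" using cl_extensive[OF Suc.prems(2)] t Suc.prems by auto
  qed (use Suc.prems in simp_all)
  moreover have "card ?S = card S" using tS card_Suc_Diff1[OF Suc.prems(1) a(1)] Suc.prems(1) by simp
  ultimately show ?case by simp
qed

lemma basis_exists:
  assumes "finite T" "T \<subseteq> R"
  shows "\<exists>B\<subseteq>T. indep B \<and> T \<subseteq> cl B"
  using assms
proof (induction T rule: finite_induct)
  case empty
  then show ?case by (auto simp: indep_empty)
next
  case (insert a T)
  then obtain B where B: "B \<subseteq> T" "indep B" "T \<subseteq> cl B" by auto
  show ?case
  proof (cases "a \<in> cl B")
    case True
    then show ?thesis using B by auto
  next
    case False
    then have "indep (insert a B)" using B insert.prems by (intro indep_insert) auto
    moreover have "insert a T \<subseteq> cl (insert a B)"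
      using cl_extensive[of "insert a B"] cl_mono[of B "insert a B"] B insert.prems by auto
    ultimately show ?thesis using B by (metis insert_mono)
  qed
qed

text \<open>Independent elements satisfy no polynomial relation modulo \<open>Q\<close>.
  Coefficients from \<open>K[S]\<close> that lie in \<open>Q\<close> are therefore actually zero,
  which allows relations to be moved between different primes.\<close>

lemma subring_gen_indep_Q:
  assumes "finite S" "indep S" shows "subring_gen K S \<inter> Q \<subseteq> {0}"
  using assms
proof (induction S rule: finite_induct)
  case empty
  then show ?case using K_Q by (auto simp: subring_gen_empty[OF subring_K])
next
  case (insert a S)
  have S: "indep S" "a \<in> R" "a \<notin> cl S" "S \<subseteq> R" using indep_insertD[OF insert.prems insert.hyps(2)] by (auto simp: indep_def)
  then have t: "trans_over (subring_gen K S) a" using notin_cl_iff_trans by simp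
  show ?case
  proof
    fix c assume "c \<in> subring_gen K (insert a S) \<inter> Q"
    then obtain p where p: "c = poly p a" "\<forall>i. coeff p i \<in> subring_gen K S" "c \<in> Q" by (auto simp: subring_gen_insert adjoin_def)
    then have "\<forall>i. coeff p i \<in> Q" using t by (auto simp: trans_over_def)
    then have "coeff p i = coeff 0 i" for i using p insert.IH[OF S(1)] by auto
    then have "p = 0" by (rule poly_eqI)
    then show "c \<in> {0}" using p by simp
  qed
qed

end

section \<open>Heights\<close>

definition deriv_on :: "'a::comm_ring_1 set \<Rightarrow> ('a \<Rightarrow> 'a) \<Rightarrow> bool" where
  "deriv_on R \<delta> \<longleftrightarrow> (\<forall>a\<in>R. \<delta> a \<in> R) \<and>
     (\<forall>a\<in>R. \<forall>b\<in>R. \<delta> (a + b) = \<delta> a + \<delta> b \<and> \<delta> (a * b) = a * \<delta> b + b * \<delta> a)"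

lemma deriv_onD:
  assumes "deriv_on R \<delta>"
  shows "a \<in> R \<Longrightarrow> \<delta> a \<in> R"
    and "a \<in> R \<Longrightarrow> b \<in> R \<Longrightarrow> \<delta> (a + b) = \<delta> a + \<delta> b"
    and "a \<in> R \<Longrightarrow> b \<in> R \<Longrightarrow> \<delta> (a * b) = a * \<delta> b + b * \<delta> a"
  using assms by (auto simp: deriv_on_def)

lemma deriv_on_0: "deriv_on R \<delta> \<Longrightarrow> 0 \<in> R \<Longrightarrow> \<delta> 0 = 0"
  using deriv_onD(2)[of R \<delta> 0 0] by simp

lemma deriv_on_1: "deriv_on R \<delta> \<Longrightarrow> 1 \<in> R \<Longrightarrow> \<delta> 1 = 0"
  using deriv_onD(3)[of R \<delta> 1 1] by simp

lemma deriv_on_funpow_R: "deriv_on R \<delta> \<Longrightarrow> a \<in> R \<Longrightarrow> (\<delta> ^^ k) a \<in> R"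
  by (induction k) (auto simp: deriv_onD)

lemma deriv_on_funpow_add:
  "deriv_on R \<delta> \<Longrightarrow> a \<in> R \<Longrightarrow> b \<in> R \<Longrightarrow> (\<delta> ^^ k) (a + b) = (\<delta> ^^ k) a + (\<delta> ^^ k) b"
  by (induction k) (auto simp: deriv_onD(2) deriv_on_funpow_R)

lemma deriv_on_kernel_subring:
  assumes R: "is_subring R" and d: "deriv_on R \<delta>"
  shows "is_subring {a \<in> R. \<delta> a = 0}"
  unfolding is_subring_def
proof (intro conjI ballI)
  show "1 \<in> {a \<in> R. \<delta> a = 0}" using deriv_on_1[OF d] subring_one[OF R] by simp
next
  fix a b assume ab: "a \<in> {a \<in> R. \<delta> a = 0}" "b \<in> {a \<in> R. \<delta> a = 0}"
  then have "a - b \<in> R" by (auto intro: subring_diff[OF R])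
  moreover from this have "\<delta> (a - b) = 0" using deriv_onD(2)[OF d, of "a - b" b] ab by simp
  ultimately show "a - b \<in> {a \<in> R. \<delta> a = 0}" by simp
  show "a * b \<in> {a \<in> R. \<delta> a = 0}" using ab deriv_onD(3)[OF d] subring_mult[OF R] by auto
qed

lemma deriv_on_poly:
  assumes R: "is_subring R" and d: "deriv_on R \<delta>" and x: "x \<in> R"
  shows "\<forall>i. coeff p i \<in> R \<Longrightarrow> \<forall>i. \<delta> (coeff p i) = 0 \<Longrightarrow> \<delta> (poly p x) = \<delta> x * poly (pderiv p) x"
proof (induction p)
  case 0
  then show ?case using deriv_on_0[OF d subring_zero[OF R]] by simp
next
  case (pCons a p)
  have a: "a \<in> R" "\<forall>i. coeff p i \<in> R" using pCons.prems by (auto simp: all_coeff_pCons)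
  have "\<delta> a = 0" "\<forall>i. \<delta> (coeff p i) = 0"
    using pCons.prems(2) by (auto dest: spec[of _ 0] spec[of _ "Suc _"])
  moreover have "poly p x \<in> R" by (rule subring_poly[OF R a(2) x])
  moreover have "x * poly p x \<in> R" using x calculation by (intro subring_mult[OF R]) auto
  ultimately show ?case using a x pCons.IH
    by (simp add: deriv_onD[OF d] pderiv_pCons algebra_simps)
qed

text \<open>Divided powers turn the Leibniz rule for iterated derivations into the multiplication
  rule of power series.\<close>

lemma deriv_on_leibniz:
  fixes \<delta> :: "'a::field_char_0 \<Rightarrow> 'a"
  assumes R: "is_subring R" and d: "deriv_on R \<delta>"
  shows "a \<in> R \<Longrightarrow> b \<in> R \<Longrightarrow>
    (\<delta> ^^ n) (a * b) / fact n = (\<Sum>k\<le>n. ((\<delta> ^^ k) a / fact k) * ((\<delta> ^^ (n - k)) b / fact (n - k)))"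
proof (induction n arbitrary: a b)
  case (Suc n)
  define dv where "dv k a = (\<delta> ^^ k) a / fact k" for k a
  have dv: "dv k (\<delta> a) = of_nat (Suc k) * dv (Suc k) a" for k a
    by (simp add: dv_def funpow_swap1 field_simps del: of_nat_Suc)
  have IH: "a \<in> R \<Longrightarrow> b \<in> R \<Longrightarrow> dv n (a * b) = (\<Sum>k\<le>n. dv k a * dv (n - k) b)" for a b
    using Suc.IH by (simp add: dv_def)
  have ab: "\<delta> a \<in> R" "\<delta> b \<in> R" using Suc.prems deriv_onD(1)[OF d] by auto
  have mem: "a * \<delta> b \<in> R" "\<delta> a * b \<in> R" using Suc.prems ab by (auto intro: subring_mult[OF R])
  have "of_nat (Suc n) * dv (Suc n) (a * b) = dv n (a * \<delta> b + \<delta> a * b)"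
    using Suc.prems by (simp add: dv[symmetric] deriv_onD(3)[OF d] mult.commute del: of_nat_Suc)
  also have "\<dots> = dv n (a * \<delta> b) + dv n (\<delta> a * b)"
    by (simp add: dv_def deriv_on_funpow_add[OF d mem] add_divide_distrib)
  also have "\<dots> = (\<Sum>k\<le>n. dv k a * dv (n - k) (\<delta> b)) + (\<Sum>k\<le>n. dv k (\<delta> a) * dv (n - k) b)"
    using IH Suc.prems ab by simp
  also have "(\<Sum>k\<le>n. dv k a * dv (n - k) (\<delta> b)) = (\<Sum>k\<le>Suc n. of_nat (Suc n - k) * (dv k a * dv (Suc n - k) b))"
    by (simp add: dv Suc_diff_le mult.left_commute del: of_nat_Suc of_nat_diff)
  also have "(\<Sum>k\<le>n. dv k (\<delta> a) * dv (n - k) b) = (\<Sum>k\<le>Suc n. of_nat k * (dv k a * dv (Suc n - k) b))"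
    by (simp add: sum.atMost_Suc_shift dv algebra_simps del: of_nat_Suc sum.atMost_Suc)
  \<comment> \<open>The weights \<open>Suc n - k\<close> and \<open>k\<close> of each term add up to
    \<open>Suc n\<close>, a common factor that is cancelled afterwards.\<close>
  also have "(\<Sum>k\<le>Suc n. of_nat (Suc n - k) * (dv k a * dv (Suc n - k) b)) +
      (\<Sum>k\<le>Suc n. of_nat k * (dv k a * dv (Suc n - k) b)) =
      of_nat (Suc n) * (\<Sum>k\<le>Suc n. dv k a * dv (Suc n - k) b)"
    unfolding sum.distrib[symmetric] sum_distrib_left distrib_right[symmetric] of_nat_add[symmetric]
    by (rule sum.cong) auto
  finally have "dv (Suc n) (a * b) = (\<Sum>k\<le>Suc n. dv k a * dv (Suc n - k) b)"
    by (metis mult_cancel_left of_nat_neq_0)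
  then show ?case by (simp add: dv_def)
qed simp

definition diff_core :: "(ratfn \<Rightarrow> ratfn) \<Rightarrow> ratfn set \<Rightarrow> ratfn set \<Rightarrow> ratfn set" where
  "diff_core \<delta> R Q = {a \<in> R. \<forall>k. (\<delta> ^^ k) a \<in> Q}"

lemma diff_core_subset: "diff_core \<delta> R Q \<subseteq> Q"
  unfolding diff_core_def by (auto dest: spec[of _ 0])

lemma diff_core_stable: "deriv_on R \<delta> \<Longrightarrow> a \<in> diff_core \<delta> R Q \<Longrightarrow> \<delta> a \<in> diff_core \<delta> R Q"
proof -
  assume d: "deriv_on R \<delta>" and a: "a \<in> diff_core \<delta> R Q"
  have "(\<delta> ^^ k) (\<delta> a) \<in> Q" for k
  proof -
    have "(\<delta> ^^ Suc k) a \<in> Q" using a unfolding diff_core_def by blast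
    then show ?thesis by (simp only: funpow_Suc_right comp_apply)
  qed
  moreover have "\<delta> a \<in> R" using a deriv_onD(1)[OF d] by (simp add: diff_core_def)
  ultimately show ?thesis by (simp add: diff_core_def)
qed

context affine_prime begin

lemma inverse_fact_R: "inverse (fact k) \<in> R"
  using inverse_K[OF subring_of_nat[OF subring_K, of "fact k"]] K_R by auto

lemma fact_R: "fact k \<in> R"
  using of_nat_R[of "fact k"] by simp

lemma Q_sum: "(\<And>i. i \<in> A \<Longrightarrow> f i \<in> Q) \<Longrightarrow> sum f A \<in> Q"
  by (induction A rule: infinite_finite_induct) (auto intro: Q_zero Q_add)

text \<open>The divided powers \<open>\<delta>^k a / k!\<close> are the coefficients of a ring
  homomorphism from \<open>R\<close> to power series over \<open>R\<close>. The core is the preimage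
  of the series with all coefficients in \<open>Q\<close>, and these form a prime ideal: the lowest
  coefficients outside \<open>Q\<close> multiply to one outside \<open>Q\<close>.\<close>

lemma diff_core_prime:
  assumes d: "deriv_on R \<delta>"
  shows "prime_in R (diff_core \<delta> R Q)"
proof -
  have dR: "a \<in> R \<Longrightarrow> (\<delta> ^^ k) a / fact k \<in> R" for a k
    using deriv_on_funpow_R[OF d] inverse_fact_R by (auto simp: divide_inverse intro: R_closed)
  have dQ: "(\<delta> ^^ k) a / fact k \<in> Q \<longleftrightarrow> (\<delta> ^^ k) a \<in> Q" if "a \<in> R" for a k
    using Q_mult[OF fact_R, of "(\<delta> ^^ k) a / fact k" k] Q_mult[OF inverse_fact_R, of "(\<delta> ^^ k) a" k]
    by (auto simp: field_simps)
  have "ideal_in R (diff_core \<delta> R Q)"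
    unfolding ideal_in_def
  proof (intro conjI ballI)
    show "diff_core \<delta> R Q \<subseteq> R" by (auto simp: diff_core_def)
    have "(\<delta> ^^ k) 0 = 0" for k by (induction k) (auto simp: deriv_on_0[OF d] R_closed)
    then show "0 \<in> diff_core \<delta> R Q" by (auto simp: diff_core_def R_closed Q_zero)
    show "a + b \<in> diff_core \<delta> R Q" if "a \<in> diff_core \<delta> R Q" "b \<in> diff_core \<delta> R Q" for a b
      using that by (auto simp: diff_core_def deriv_on_funpow_add[OF d] intro: R_closed Q_add)
    fix r a assume ra: "r \<in> R" "a \<in> diff_core \<delta> R Q"
    then have aR: "a \<in> R" by (auto simp: diff_core_def)
    have "(\<delta> ^^ n) (r * a) \<in> Q" for n
    proof -
      have "(\<delta> ^^ k) a / fact k \<in> Q" for k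
        using ra dQ[OF aR] by (simp add: diff_core_def)
      then have "(\<Sum>k\<le>n. ((\<delta> ^^ k) r / fact k) * ((\<delta> ^^ (n - k)) a / fact (n - k))) \<in> Q"
        by (intro Q_sum Q_mult dR ra)
      then have "(\<delta> ^^ n) (r * a) / fact n \<in> Q"
        unfolding deriv_on_leibniz[OF subring_R d ra(1) aR] .
      then show ?thesis using dQ[OF R_closed(3)[OF ra(1) aR]] by simp
    qed
    then show "r * a \<in> diff_core \<delta> R Q" using ra aR by (auto simp: diff_core_def R_closed)
  qed
  moreover have "diff_core \<delta> R Q \<noteq> R" using diff_core_subset one_notin_Q R_closed(7) by blast
  moreover have "a \<in> diff_core \<delta> R Q \<or> b \<in> diff_core \<delta> R Q"
    if ab: "a \<in> R" "b \<in> R" and c: "a * b \<in> diff_core \<delta> R Q" for a b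
  proof (rule ccontr)
    assume n: "\<not> ?thesis"
    define P where "P c k \<longleftrightarrow> (\<delta> ^^ k) c \<notin> Q" for c k
    obtain i where i: "P a i" "\<And>k. k < i \<Longrightarrow> \<not> P a k"
      using n ab exists_least_iff[of "P a"] by (auto simp: diff_core_def P_def)
    obtain j where j: "P b j" "\<And>k. k < j \<Longrightarrow> \<not> P b k"
      using n ab exists_least_iff[of "P b"] by (auto simp: diff_core_def P_def)
    let ?t = "\<lambda>k. ((\<delta> ^^ k) a / fact k) * ((\<delta> ^^ (i + j - k)) b / fact (i + j - k))"
    \<comment> \<open>In the coefficient of index \<open>i + j\<close> every term but
      \<open>k = i\<close> has a factor below the order of \<open>a\<close> or of \<open>b\<close>,
      where the coefficients still lie in \<open>Q\<close>.\<close>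
    have small: "?t k \<in> Q" if "k \<le> i + j" "k \<noteq> i" for k
    proof (cases "k < i")
      case True
      then have "(\<delta> ^^ k) a / fact k \<in> Q" using i dQ[OF ab(1)] by (auto simp: P_def)
      then show ?thesis by (rule Q_mult2[OF dR[OF ab(2)]])
    next
      case False
      then have "i + j - k < j" using that by auto
      then have "(\<delta> ^^ (i + j - k)) b / fact (i + j - k) \<in> Q" using j dQ[OF ab(2)] by (auto simp: P_def)
      then show ?thesis by (rule Q_mult[OF dR[OF ab(1)]])
    qed
    have "(\<Sum>k\<in>{..i + j} - {i}. ?t k) \<in> Q"
      by (rule Q_sum, rule small) auto
    moreover have "(\<Sum>k\<le>i + j. ?t k) \<in> Q"
      unfolding deriv_on_leibniz[OF subring_R d ab, symmetric]
      using c dQ[OF R_closed(3)[OF ab]] by (simp add: diff_core_def)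
    moreover have "(\<Sum>k\<le>i + j. ?t k) = ?t i + (\<Sum>k\<in>{..i + j} - {i}. ?t k)"
      by (rule sum.remove) auto
    ultimately have "?t i \<in> Q" using Q_diff by fastforce
    then show False
      using Q_cancel[OF _ dR[OF ab(1)] dR[OF ab(2)]] i(1) j(1) dQ[OF ab(1)] dQ[OF ab(2)]
      by (auto simp: P_def)
  qed
  ultimately show ?thesis by (auto simp: prime_in_def)
qed

end

section \<open>Independence under change of the prime or of the algebra\<close>

context affine_prime begin

text \<open>A relation modulo \<open>P\<close> is one modulo \<open>Q\<close>, so its coefficients
  lie in \<open>Q\<close>; coming from \<open>K[S]\<close> with \<open>S\<close> independent, they
  are zero.\<close>

lemma indep_below:
  assumes P: "prime_in R P" "P \<subseteq> Q" and S: "finite S" "indep S"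
  shows "affine_prime.indep K R P S"
proof -
  interpret P: affine_prime K R G P by unfold_locales (rule P)
  show ?thesis
    using S
  proof (induction S rule: finite_induct)
    case empty
    show ?case by (rule P.indep_empty)
  next
    case (insert a S)
    have S: "indep S" "a \<in> R" "a \<notin> cl S" "S \<subseteq> R"
      using indep_insertD[OF insert.prems insert.hyps(2)] by (auto simp: indep_def)
    have t: "trans_over (subring_gen K S) a" using S notin_cl_iff_trans by simp
    have "P.trans_over (subring_gen K S) a"
      unfolding P.trans_over_def
    proof (intro allI impI)
      fix p i assume p: "\<forall>i. coeff p i \<in> subring_gen K S" "poly p a \<in> P"
      then have "coeff p i \<in> subring_gen K S \<inter> Q" using t P(2) by (auto simp: trans_over_def)
      then show "coeff p i \<in> P" using subring_gen_indep_Q[OF insert.hyps(1) S(1)] P.Q_zero by auto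
    qed
    then show ?case
      using P.notin_cl_iff_trans[OF S(4,2)] insert.IH[OF S(1)] S(2) by (intro P.indep_insert) auto
  qed
qed

text \<open>The transcendence degree drops strictly from \<open>P\<close> to \<open>Q\<close>: any
  \<open>q\<close> in \<open>Q\<close> but not in \<open>P\<close> is transcendental over
  \<open>K[S]\<close> modulo \<open>P\<close>. The constant term of a relation lies in
  \<open>Q\<close> and is therefore zero; then a factor \<open>q\<close> can be cancelled, and one
  continues with the next coefficient.\<close>

lemma indep_grow:
  assumes P: "prime_in R P" "P \<subset> Q" and S: "finite S" "indep S"
  obtains q where "q \<in> R" "q \<notin> S" "affine_prime.indep K R P (insert q S)"
proof -
  interpret P: affine_prime K R G P by unfold_locales (rule P)
  obtain q where q: "q \<in> Q" "q \<notin> P" using P(2) by auto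
  have qR: "q \<in> R" using q Q_R by auto
  have SR: "S \<subseteq> R" using S by (auto simp: indep_def)
  have coeffs: "\<forall>i. coeff p i \<in> P" if "\<forall>i. coeff p i \<in> subring_gen K S" "poly p q \<in> P" for p
    using that
  proof (induction p)
    case (pCons c p)
    have c: "c \<in> subring_gen K S" "\<forall>i. coeff p i \<in> subring_gen K S" using pCons.prems(1) by (auto simp: all_coeff_pCons)
    then have pR: "poly p q \<in> R"
      using subring_gen_R[OF SR] qR by (intro subring_poly subring_R) auto
    have "c + q * poly p q \<in> Q" using pCons.prems(2) P(2) by auto
    then have "c \<in> Q" using Q_diff[OF _ Q_mult2[OF pR q(1)]] by fastforce
    then have c0: "c = 0" using c subring_gen_indep_Q[OF S] by auto
    then have "q * poly p q \<in> P" using pCons.prems(2) by simp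
    then have "poly p q \<in> P" using P.Q_cancel qR pR q(2) by blast
    then show ?case using pCons.IH c c0 P.Q_zero by (auto simp: all_coeff_pCons)
  qed (simp add: P.Q_zero)
  then have "P.trans_over (subring_gen K S) q" by (auto simp: P.trans_over_def)
  then have n: "q \<notin> P.cl S" using P.notin_cl_iff_trans[OF SR qR] by simp
  have "P.indep (insert q S)"
    using n qR indep_below[OF P(1) _ S] P(2) by (intro P.indep_insert) auto
  moreover have "q \<notin> S" using n P.cl_extensive[OF SR] by auto
  ultimately show thesis using that qR by blast
qed

end

text \<open>A polynomial over \<open>B\<close> has its value at \<open>a\<close> in
  \<open>C\<close>, and inside \<open>C\<close> membership in \<open>P\<close> and in
  \<open>Q\<close> is the same. This permits comparing the degrees of \<open>C\<close> modulo
  \<open>P\<close> and of \<open>R\<close> modulo \<open>Q\<close>.\<close>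

lemma trans_over_restrict:
  assumes C: "affine_prime K C G' P" and R: "affine_prime K R G Q" and sub: "C \<subseteq> R" "P = Q \<inter> C"
    and B: "B \<subseteq> C" and a: "a \<in> C"
  shows "affine_prime.trans_over P B a \<longleftrightarrow> affine_prime.trans_over Q B a"
proof -
  interpret C: affine_prime K C G' P by (rule C)
  interpret R: affine_prime K R G Q by (rule R)
  have "poly p a \<in> C" if "\<forall>i. coeff p i \<in> B" for p
    using that B a by (intro subring_poly C.subring_R) auto
  then show ?thesis unfolding C.trans_over_def R.trans_over_def using B unfolding sub(2) by blast
qed

lemma cl_restrict:
  assumes C: "affine_prime K C G' P" and R: "affine_prime K R G Q" and sub: "C \<subseteq> R" "P = Q \<inter> C"
    and S: "S \<subseteq> C" and a: "a \<in> C"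
  shows "a \<in> affine_prime.cl K C P S \<longleftrightarrow> a \<in> affine_prime.cl K R Q S"
proof -
  interpret C: affine_prime K C G' P by (rule C)
  interpret R: affine_prime K R G Q by (rule R)
  have "subring_gen K S \<subseteq> C" by (rule C.subring_gen_R[OF S])
  from trans_over_restrict[OF C R sub this a] show ?thesis
    using C.notin_cl_iff_trans[OF S a] R.notin_cl_iff_trans[of S a] S a sub by blast
qed

lemma indep_restrict:
  assumes C: "affine_prime K C G' P" and R: "affine_prime K R G Q" and sub: "C \<subseteq> R" "P = Q \<inter> C"
    and S: "affine_prime.indep K C P S"
  shows "affine_prime.indep K R Q S"
proof -
  interpret C: affine_prime K C G' P by (rule C)
  interpret R: affine_prime K R G Q by (rule R)
  have SC: "S \<subseteq> C" "\<forall>a\<in>S. a \<notin> C.cl (S - {a})" using S by (auto simp: C.indep_def)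
  then have "a \<notin> R.cl (S - {a})" if "a \<in> S" for a
    using cl_restrict[OF C R sub, of "S - {a}" a] that by auto
  then show ?thesis using SC sub by (auto simp: R.indep_def)
qed

text \<open>A localized polynomial ring: \<open>dd\<close> are the derivations dual to the
  coordinates \<open>X\<close>, and \<open>loc\<close> says that every element is a polynomial in
  the coordinates up to a unit. Both \<open>A_\<gamma>\<close> with \<open>N = n\<close> and
  \<open>C_\<gamma>\<close> with \<open>N = n - 2\<close> are of this kind.\<close>

locale affine_coords = affine_ring +
  fixes N :: nat and X :: "nat \<Rightarrow> ratfn" and dd :: "nat \<Rightarrow> ratfn \<Rightarrow> ratfn"
  assumes X_R: "i < N \<Longrightarrow> X i \<in> R"
    and dd: "i < N \<Longrightarrow> deriv_on R (dd i)"
    and dd_K: "i < N \<Longrightarrow> c \<in> K \<Longrightarrow> dd i c = 0"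
    and dd_X: "i < N \<Longrightarrow> j < N \<Longrightarrow> dd i (X j) = (if i = j then 1 else 0)"
    and loc: "a \<in> R \<Longrightarrow> \<exists>m\<in>subring_gen K (X ` {..<N}). m \<noteq> 0 \<and> inverse m \<in> R \<and> a * m \<in> subring_gen K (X ` {..<N})"
begin

section \<open>The height formula in a localized polynomial ring\<close>

lemma prime_affine: "prime_in R Q \<Longrightarrow> affine_prime K R G Q"
  by unfold_locales

lemma inj_X: "inj_on X {..<N}"
proof (rule inj_onI)
  fix i j assume "i \<in> {..<N}" "j \<in> {..<N}" "X i = X j"
  then show "i = j" using dd_X[of i i] dd_X[of i j] by (auto split: if_splits)
qed

lemma deriv_mod_vanish_coords:
  assumes Q: "prime_in R Q" and D: "affine_prime.deriv_mod K R Q R D"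
    and X: "\<And>i. i < N \<Longrightarrow> D (X i) \<in> Q" and a: "a \<in> R"
  shows "D a \<in> Q"
proof -
  interpret affine_prime K R G Q by (rule prime_affine[OF Q])
  have XR: "X ` {..<N} \<subseteq> R" using X_R by auto
  obtain m where m: "m \<in> subring_gen K (X ` {..<N})" "m \<noteq> 0" "inverse m \<in> R" "a * m \<in> subring_gen K (X ` {..<N})"
    using loc[OF a] by blast
  have mR: "m \<in> R" using m subring_gen_R[OF XR] by auto
  have "D (a * m) \<in> Q" "D m \<in> Q" using deriv_mod_vanish_gen[OF D XR] X m by auto
  then have "a * D m + m * D a \<in> Q" "a * D m \<in> Q"
    using Q_iff[OF deriv_modD(3)[OF D a mR]] a by (auto intro: Q_mult)
  then have "m * D a \<in> Q" using Q_diff by fastforce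
  then show ?thesis using Q_cancel mR deriv_modD(1)[OF D a] unit_notin_Q m by blast
qed

lemma cl_coords:
  assumes Q: "prime_in R Q" shows "affine_prime.cl K R Q (X ` {..<N}) = R"
proof -
  interpret affine_prime K R G Q by (rule prime_affine[OF Q])
  show ?thesis using deriv_mod_vanish_coords[OF Q] by (auto simp: cl_def deriv_quot_def)
qed

lemma card_indep_le:
  assumes Q: "prime_in R Q" and S: "finite S" "affine_prime.indep K R Q S"
  shows "card S \<le> N"
proof -
  interpret affine_prime K R G Q by (rule prime_affine[OF Q])
  have "card S \<le> card (X ` {..<N})"
    using S cl_coords[OF Q] X_R by (intro steinitz) (auto simp: indep_def)
  then show ?thesis using card_image[OF inj_X] by simp
qed

text \<open>Walking down the chain, each strict inclusion enlarges the independent set by one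
  element, and no independent set has more than \<open>N\<close> elements.\<close>

lemma chain_bound:
  "(\<forall>j\<le>k. prime_in R (c j)) \<Longrightarrow> (\<forall>j<k. c j \<subset> c (Suc j)) \<Longrightarrow> finite S \<Longrightarrow>
   affine_prime.indep K R (c k) S \<Longrightarrow> card S + k \<le> N"
proof (induction k arbitrary: S)
  case 0
  then show ?case using card_indep_le by auto
next
  case (Suc k)
  interpret affine_prime K R G "c (Suc k)" by (rule prime_affine) (use Suc.prems in auto)
  have "prime_in R (c k)" "c k \<subset> c (Suc k)" using Suc.prems by auto
  from indep_grow[OF this Suc.prems(3,4)] obtain q where
    q: "q \<notin> S" "affine_prime.indep K R (c k) (insert q S)" by blast
  have "card (insert q S) + k \<le> N"
    using Suc.prems q by (intro Suc.IH) auto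
  then show ?case using q Suc.prems(3) by simp
qed

text \<open>The list is worked off from its end, so that the suffixes of one list give an increasing
  family of ideals ending in \<open>Q\<close>.\<close>

fun freed :: "nat list \<Rightarrow> ratfn set \<Rightarrow> ratfn set" where
  "freed [] Q = Q"
| "freed (z # zs) Q = diff_core (dd z) R (freed zs Q)"

lemma freed_prime:
  assumes "prime_in R Q" shows "set zs \<subseteq> {..<N} \<Longrightarrow> prime_in R (freed zs Q)"
proof (induction zs)
  case (Cons z zs)
  then interpret affine_prime K R G "freed zs Q" by (intro prime_affine) auto
  show ?case using Cons.prems by (auto intro!: diff_core_prime dd)
qed (simp add: assms)

lemma freed_subset: "freed zs Q \<subseteq> Q"
proof (induction zs)
  case (Cons z zs)
  then show ?case using diff_core_subset[of "dd z" R "freed zs Q"] by auto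
qed simp

text \<open>An algebraic relation between \<open>X z\<close> and the independent coordinates \<open>X ` B\<close> lies in
  \<open>freed zs Q\<close> exactly as long as \<open>z\<close> has not been freed.\<close>

lemma freed_strict:
  assumes Q: "prime_in R Q" and B: "B \<subseteq> {..<N}" "affine_prime.indep K R Q (X ` B)"
    and z: "z < N" "X z \<in> affine_prime.cl K R Q (X ` B)" and zs: "set zs \<subseteq> {..<N} - B" "z \<notin> set zs" "z \<notin> B"
  shows "freed (z # zs) Q \<subset> freed zs Q"
proof -
  interpret affine_prime K R G Q by (rule prime_affine[OF Q])
  have XB: "X ` B \<subseteq> R" using B X_R by auto
  obtain p where p: "\<forall>i. coeff p i \<in> subring_gen K (X ` B)" "poly p (X z) \<in> Q" "\<not> (\<forall>i. coeff p i \<in> Q)"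
    using notin_cl_iff_trans[OF XB X_R[OF z(1)]] z(2) by (auto simp: trans_over_def)
  define f where "f = poly p (X z)"
  have kill: "dd w a = 0" if "w < N" "w \<notin> V" "V \<subseteq> {..<N}" "a \<in> subring_gen K (X ` V)" for w V a
  proof -
    have "subring_gen K (X ` V) \<subseteq> {a \<in> R. dd w a = 0}"
      using that K_R X_R dd_K dd_X
      by (intro subring_gen_least deriv_on_kernel_subring subring_R dd) auto
    then show ?thesis using that by auto
  qed
  have fgen: "f \<in> subring_gen K (X ` insert z B)"
    using p by (auto simp: f_def subring_gen_insert adjoin_def)
  then have fR: "f \<in> R" using subring_gen_R[of "X ` insert z B"] XB X_R[OF z(1)] by auto
  \<comment> \<open>\<open>f\<close> involves only \<open>X z\<close> and the coordinates in
    \<open>B\<close>, so the derivations along all variables freed here annihilate it.\<close>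
  have in_freed: "f \<in> freed ws Q" if "set ws \<subseteq> {..<N} - B" "z \<notin> set ws" for ws
    using that
  proof (induction ws)
    case (Cons w ws)
    have "dd w f = 0" using Cons.prems B z(1) by (intro kill[OF _ _ _ fgen]) auto
    moreover have "(dd w ^^ k) 0 = 0" for k
      using Cons.prems by (induction k) (auto intro!: deriv_on_0[OF dd] R_closed)
    ultimately have "(dd w ^^ k) f \<in> freed ws Q" for k
      using Cons freed_prime[OF Q, of ws]
      by (cases k) (auto simp: funpow_swap1 prime_in_def ideal_in_def)
    then show ?case using fR by (simp add: diff_core_def)
  qed (use p in \<open>simp add: f_def\<close>)
  have "f \<notin> freed (z # zs) Q"
  proof
    assume "f \<in> freed (z # zs) Q"
    then have f: "(dd z ^^ k) f \<in> Q" for k using freed_subset[of zs Q] by (auto simp: diff_core_def)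
    have c: "\<forall>i. coeff ((pderiv ^^ k) p) i \<in> subring_gen K (X ` B)" for k
    proof (induction k)
      case (Suc k)
      then show ?case
        by (auto simp: coeff_pderiv simp del: of_nat_Suc intro!: subring_mult subring_of_nat subring_gen_subring)
    qed (use p in simp)
    have step: "(dd z ^^ k) f = poly ((pderiv ^^ k) p) (X z)" for k
    proof (induction k)
      case (Suc k)
      have "dd z (poly ((pderiv ^^ k) p) (X z)) = dd z (X z) * poly (pderiv ((pderiv ^^ k) p)) (X z)"
        using c[of k] subring_gen_R[OF XB] kill[OF z(1) zs(3) B(1)]
        by (intro deriv_on_poly[OF subring_R dd[OF z(1)] X_R[OF z(1)]]) auto
      then show ?case using Suc dd_X[OF z(1) z(1)] by simp
    qed (simp add: f_def)
    \<comment> \<open>The coefficients of \<open>p\<close> are constants for \<open>dd z\<close>, so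
      differentiating \<open>degree p\<close> times leaves \<open>n!\<close> times the leading
      coefficient. This is a nonzero element of \<open>K[X B]\<close> and cannot lie in
      \<open>Q\<close>.\<close>
    define n where "n = degree p"
    have "degree ((pderiv ^^ n) p) = 0" by (simp add: degree_higher_pderiv n_def)
    then obtain d where "(pderiv ^^ n) p = [:d:]" by (rule degree_eq_zeroE)
    then have "poly ((pderiv ^^ n) p) (X z) = coeff ((pderiv ^^ n) p) 0" by simp
    also have "\<dots> = fact n * lead_coeff p"
      by (simp add: coeff_higher_pderiv n_def pochhammer_fact)
    finally have "fact n * lead_coeff p \<in> Q" using f[of n] step[of n] by simp
    moreover have "fact n * lead_coeff p \<in> subring_gen K (X ` B)"
      using subring_mult[OF subring_gen_subring subring_of_nat[OF subring_gen_subring, of "fact n" K "X ` B"]] p(1) by auto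
    moreover have "finite (X ` B)" using B finite_subset by blast
    ultimately have "fact n * lead_coeff p = 0" using subring_gen_indep_Q[OF _ B(2)] by blast
    then have "p = 0" by simp
    then show False using p(3) by (simp add: Q_zero)
  qed
  moreover have "f \<in> freed zs Q" by (rule in_freed) (use zs in auto)
  ultimately show ?thesis using diff_core_subset[of "dd z" R "freed zs Q"] by auto
qed

lemma height_formula:
  assumes Q: "prime_in R Q" and S: "finite S" "affine_prime.indep K R Q S" "R \<subseteq> affine_prime.cl K R Q S"
  shows "height_in R Q = enat (N - card S)"
proof -
  interpret affine_prime K R G Q by (rule prime_affine[OF Q])
  have XR: "X ` {..<N} \<subseteq> R" using X_R by auto
  obtain B' where B': "B' \<subseteq> X ` {..<N}" "indep B'" "X ` {..<N} \<subseteq> cl B'"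
    using basis_exists[OF _ XR] by blast
  then obtain B where B: "B \<subseteq> {..<N}" "B' = X ` B" by (auto simp: subset_image_iff)
  have finB: "finite B" using B finite_subset by blast
  have SR: "S \<subseteq> R" "B' \<subseteq> R" using S B' by (auto simp: indep_def)
  have "cl B' = R" using cl_closed[OF B'(3)] cl_coords[OF Q] cl_R by auto
  then have "card S = card B'"
    using steinitz[of B' S] steinitz[of S B'] S SR finB B B' by (intro antisym) auto
  also have "\<dots> = card B" using B inj_on_subset[OF inj_X B(1)] by (simp add: card_image)
  finally have cardB: "card S = card B" .
  define zs where "zs = sorted_list_of_set ({..<N} - B)"
  have zs: "set zs = {..<N} - B" "distinct zs" by (auto simp: zs_def)
  have "length zs = card ({..<N} - B)" using zs distinct_card by metis
  also have "\<dots> = N - card S" using B finB cardB by (simp add: card_Diff_subset)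
  finally have len: "length zs = N - card S" .
  \<comment> \<open>A transcendence basis \<open>B\<close> is chosen among the coordinates. At
    \<open>j = 0\<close> all other coordinates are freed; each step gives up one of them, and after
    \<open>N - card S\<close> steps \<open>Q\<close> is reached.\<close>
  define c where "c j = freed (drop j zs) Q" for j
  have chain: "(\<forall>j\<le>N - card S. prime_in R (c j)) \<and> (\<forall>j<N - card S. c j \<subset> c (Suc j)) \<and> c (N - card S) = Q"
  proof (intro conjI allI impI)
    show "prime_in R (c j)" for j
      using set_drop_subset[of j zs] zs unfolding c_def by (intro freed_prime Q) auto
    show "c (N - card S) = Q" by (simp add: c_def flip: len)
    fix j assume j: "j < N - card S"
    have *: "drop j zs = zs ! j # drop (Suc j) zs" using j len by (simp add: Cons_nth_drop_Suc)
    have "zs ! j \<in> set zs" using j len by simp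
    then have z: "zs ! j < N" "zs ! j \<notin> B" using zs by auto
    have "distinct (zs ! j # drop (Suc j) zs)" using zs(2) unfolding *[symmetric] by simp
    then have n: "zs ! j \<notin> set (drop (Suc j) zs)" by simp
    have "set (drop (Suc j) zs) \<subseteq> {..<N} - B" using set_drop_subset[of "Suc j" zs] zs by auto
    from freed_strict[OF Q B(1) _ z(1) _ this n z(2)] B' B z(1)
    show "c j \<subset> c (Suc j)" by (auto simp: c_def *)
  qed
  show ?thesis
    unfolding height_in_def
  proof (rule antisym)
    show "Sup {enat k |k. \<exists>c. (\<forall>j\<le>k. prime_in R (c j)) \<and> (\<forall>j<k. c j \<subset> c (Suc j)) \<and> c k = Q} \<le> enat (N - card S)"
    proof (rule Sup_least)
      fix h assume "h \<in> {enat k |k. \<exists>c. (\<forall>j\<le>k. prime_in R (c j)) \<and> (\<forall>j<k. c j \<subset> c (Suc j)) \<and> c k = Q}"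
      then obtain k c where k: "h = enat k" "\<forall>j\<le>k. prime_in R (c j)" "\<forall>j<k. c j \<subset> c (Suc j)" "c k = Q" by blast
      then have "card S + k \<le> N" using S by (intro chain_bound[of k c]) auto
      then show "h \<le> enat (N - card S)" using k(1) by simp
    qed
    show "enat (N - card S) \<le> Sup {enat k |k. \<exists>c. (\<forall>j\<le>k. prime_in R (c j)) \<and> (\<forall>j<k. c j \<subset> c (Suc j)) \<and> c k = Q}"
      by (rule Sup_upper) (use chain in blast)
  qed
qed

end

section \<open>Polynomials and rational functions\<close>

lemma mpoly_sum_single: "(p :: 'a \<Rightarrow>\<^sub>0 'b::comm_monoid_add) =
  (\<Sum>m\<in>Poly_Mapping.keys p. Poly_Mapping.single m (Poly_Mapping.lookup p m))"
proof (rule poly_mapping_eqI)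
  fix k
  have "Poly_Mapping.lookup p k = (\<Sum>m\<in>Poly_Mapping.keys p. if m = k then Poly_Mapping.lookup p m else 0)"
    by (simp add: sum.delta' in_keys_iff)
  also have "\<dots> = (\<Sum>m\<in>Poly_Mapping.keys p. Poly_Mapping.lookup (Poly_Mapping.single m (Poly_Mapping.lookup p m)) k)"
    by (rule sum.cong) (auto simp: lookup_single when_def)
  finally show "Poly_Mapping.lookup p k =
      Poly_Mapping.lookup (\<Sum>m\<in>Poly_Mapping.keys p. Poly_Mapping.single m (Poly_Mapping.lookup p m)) k"
    by (simp add: lookup_sum)
qed

lemma mpoly_induct [case_names single add]:
  fixes p :: "'a \<Rightarrow>\<^sub>0 'b::comm_monoid_add"
  assumes single: "\<And>m c. P (Poly_Mapping.single m c)" and add: "\<And>p q. P p \<Longrightarrow> P q \<Longrightarrow> P (p + q)"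
  shows "P p"
proof -
  have "P (\<Sum>m\<in>A. Poly_Mapping.single m (Poly_Mapping.lookup p m))" if "finite A" for A
    using that by (induction A rule: finite_induct) (use single[of undefined 0] in \<open>auto intro: single add\<close>)
  from this[OF finite_keys[of p]] show ?thesis using mpoly_sum_single[of p] by simp
qed

lemma Apoly_subring: "is_subring (Apoly n)"
  unfolding is_subring_def
proof (intro conjI ballI)
  show "1 \<in> Apoly n" by (simp add: Apoly_def)
  fix p q assume pq: "p \<in> Apoly n" "q \<in> Apoly n"
  have "Poly_Mapping.keys (p - q) \<subseteq> Poly_Mapping.keys p \<union> Poly_Mapping.keys q"
    by (auto simp: in_keys_iff lookup_minus)
  then show "p - q \<in> Apoly n" using pq unfolding Apoly_def by blast
  show "p * q \<in> Apoly n"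
    unfolding Apoly_def
  proof (intro CollectI ballI)
    fix m i assume "m \<in> Poly_Mapping.keys (p * q)" "i \<in> Poly_Mapping.keys m"
    then obtain a b where "a \<in> Poly_Mapping.keys p" "b \<in> Poly_Mapping.keys q" "i \<in> Poly_Mapping.keys (a + b)"
      using keys_mult by fastforce
    then show "i < n" using pq keys_add[of a b] unfolding Apoly_def by blast
  qed
qed

lemma single_in_Apoly: "(\<And>i. i \<in> Poly_Mapping.keys m \<Longrightarrow> i < n) \<Longrightarrow> Poly_Mapping.single m c \<in> Apoly n"
  by (auto simp: Apoly_def)

lemma mp_const_Apoly: "mp_const c \<in> Apoly n"
  unfolding mp_const_def by (rule single_in_Apoly) simp

lemma mp_const_hom:
  "mp_const (a + b) = mp_const a + mp_const b" "mp_const (a * b) = mp_const a * mp_const b"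
  "mp_const (a - b) = mp_const a - mp_const b" "mp_const 1 = 1" "mp_const 0 = 0"
  by (simp_all add: mp_const_def single_add single_diff mult_single)

section \<open>Partial derivatives of polynomials and rational functions\<close>

lemma mp_pderiv_single:
  "mp_pderiv i (Poly_Mapping.single m c) =
   Poly_Mapping.single (m - Poly_Mapping.single i 1) (of_nat (Poly_Mapping.lookup m i) * c)"
  by (cases "c = 0") (simp_all add: mp_pderiv_def)

lemma mp_pderiv_add: "mp_pderiv i (p + q) = mp_pderiv i p + mp_pderiv i q"
  unfolding mp_pderiv_def
  by (rule setsum_keys_plus_distrib) (simp_all add: single_add[symmetric] algebra_simps)

lemma mp_pderiv_mult_single:
  "mp_pderiv i (Poly_Mapping.single m a * Poly_Mapping.single k b) =
   Poly_Mapping.single m a * mp_pderiv i (Poly_Mapping.single k b) +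
   Poly_Mapping.single k b * mp_pderiv i (Poly_Mapping.single m a)"
proof -
  let ?e = "Poly_Mapping.single i (1::nat)"
  \<comment> \<open>Subtraction of exponents is truncated. The two exponents can differ only if the
    variable does not occur in \<open>y\<close>, and then the coefficient is 0.\<close>
  have *: "Poly_Mapping.single (x + (y - ?e)) (of_nat (Poly_Mapping.lookup y i) * c) =
      Poly_Mapping.single (x + y - ?e) (of_nat (Poly_Mapping.lookup y i) * c)" for x y and c :: complex
  proof (cases "Poly_Mapping.lookup y i = 0")
    case False
    then have "x + (y - ?e) = x + y - ?e"
      by (intro poly_mapping_eqI)
        (auto simp: lookup_add Poly_Mapping.minus_poly_mapping.rep_eq lookup_single when_def)
    then show ?thesis by simp
  qed simp
  show ?thesis
    using *[of m k "a * b"] *[of k m "a * b"]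
    by (simp add: mult_single mp_pderiv_single lookup_add ac_simps single_add[symmetric] distrib_left distrib_right)
qed

lemma mp_pderiv_mult: "mp_pderiv i (p * q) = p * mp_pderiv i q + q * mp_pderiv i p"
proof (induction p rule: mpoly_induct)
  case (single m a)
  show ?case
  proof (induction q rule: mpoly_induct)
    case (single k b)
    show ?case by (rule mp_pderiv_mult_single)
  qed (simp add: mp_pderiv_add algebra_simps)
qed (simp add: mp_pderiv_add algebra_simps)

lemma mp_pderiv_Apoly: "p \<in> Apoly n \<Longrightarrow> mp_pderiv i p \<in> Apoly n"
  unfolding mp_pderiv_def
proof (intro subring_sum[OF Apoly_subring] single_in_Apoly)
  fix m j assume "p \<in> Apoly n" "m \<in> Poly_Mapping.keys p" "j \<in> Poly_Mapping.keys (m - Poly_Mapping.single i 1)"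
  moreover from this have "j \<in> Poly_Mapping.keys m"
    by (auto simp: in_keys_iff Poly_Mapping.minus_poly_mapping.rep_eq)
  ultimately show "j < n" by (auto simp: Apoly_def)
qed

lemma Fract_hom: "Fract (p * q) 1 = Fract p 1 * Fract q (1::mpoly)" "Fract (p + q) 1 = Fract p 1 + Fract q (1::mpoly)"
  "Fract (p - q) 1 = Fract p 1 - Fract q (1::mpoly)" "Fract 1 1 = (1::ratfn)" "Fract 0 1 = (0::ratfn)"
  by (simp_all add: fract_collapse)

lemma Fract_prod: "Fract (prod f A) 1 = (\<Prod>i\<in>A. Fract (f i) (1::mpoly))"
  by (induction A rule: infinite_finite_induct) (simp_all add: Fract_hom del: mult_fract)

lemma Fract_power: "Fract (p ^ k) 1 = Fract p (1::mpoly) ^ k"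
  by (induction k) (simp_all add: Fract_hom del: mult_fract)

lemma mp_pderiv_const: "mp_pderiv i (mp_const c) = 0" "mp_pderiv i 1 = 0"
  by (simp_all add: mp_const_def mp_pderiv_single flip: single_one)

text \<open>The quotient rule gives the same value for all representatives, as one sees by
  differentiating \<open>a * d = c * b\<close>; so the arbitrary choice in the definition does no
  harm.\<close>

lemma fr_pderiv_Fract:
  assumes "b \<noteq> 0"
  shows "fr_pderiv i (Fract a b) = Fract (mp_pderiv i a * b - a * mp_pderiv i b) (b * b)"
proof -
  define z where "z = (SOME (c, d). d \<noteq> 0 \<and> Fract a b = Fract c d)"
  obtain c d where z: "z = (c, d)" by fastforce
  have "case z of (c, d) \<Rightarrow> d \<noteq> 0 \<and> Fract a b = Fract c d"
    unfolding z_def by (rule someI[of _ "(a, b)"]) (use assms in simp)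
  then have d: "d \<noteq> 0" "Fract a b = Fract c d" by (auto simp: z)
  then have eq: "a * d = c * b" using assms by (simp add: eq_fract)
  define a' b' c' d' where "a' = mp_pderiv i a" "b' = mp_pderiv i b" "c' = mp_pderiv i c" "d' = mp_pderiv i d"
  have eq': "a * d' + d * a' = c * b' + b * c'"
    using arg_cong[OF eq, of "mp_pderiv i"] by (simp add: mp_pderiv_mult a'_b'_c'_d'_def)
  have da: "d * a' = c * b' + b * c' - a * d'" using eq' by (simp add: algebra_simps)
  have "(a' * b - a * b') * (d * d) = (c' * d - c * d') * (b * b)"
  proof -
    have "(a' * b - a * b') * (d * d) = b * d * (d * a') - b' * d * (a * d)" by (simp add: algebra_simps)
    also have "\<dots> = b * d * (c * b' + b * c' - a * d') - b' * d * (c * b)"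
      by (simp only: eq da)
    also have "\<dots> = b * b * d * c' - b * d' * (a * d)" by (simp add: algebra_simps)
    also have "\<dots> = (c' * d - c * d') * (b * b)" unfolding eq by (simp add: algebra_simps)
    finally show ?thesis .
  qed
  then have "Fract (c' * d - c * d') (d * d) = Fract (a' * b - a * b') (b * b)"
    using assms d(1) by (simp add: eq_fract)
  moreover have "fr_pderiv i (Fract a b) = Fract (c' * d - c * d') (d * d)"
    unfolding fr_pderiv_def z_def[symmetric] z by (simp add: a'_b'_c'_d'_def)
  ultimately show ?thesis by (simp add: a'_b'_c'_d'_def)
qed

lemma fr_pderiv_deriv: "deriv_on UNIV (fr_pderiv i)"
  unfolding deriv_on_def
proof (intro conjI ballI)
  fix x y :: ratfn
  obtain a b where x: "x = Fract a b" "b \<noteq> 0" by (cases x)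
  obtain c d where y: "y = Fract c d" "d \<noteq> 0" by (cases y)
  show "fr_pderiv i (x + y) = fr_pderiv i x + fr_pderiv i y"
    using x y by (simp add: fr_pderiv_Fract eq_fract mp_pderiv_add mp_pderiv_mult algebra_simps)
  show "fr_pderiv i (x * y) = x * fr_pderiv i y + y * fr_pderiv i x"
    using x y by (simp add: fr_pderiv_Fract eq_fract mp_pderiv_mult algebra_simps)
qed simp

section \<open>Constants, coordinate functions and evaluation of polynomials\<close>

definition consts_ratfn :: "ratfn set" where
  "consts_ratfn = {Fract (mp_const c) 1 | c. True}"

definition ratvar :: "nat \<Rightarrow> ratfn" where
  "ratvar i = Fract (Poly_Mapping.single (Poly_Mapping.single i 1) 1) 1"

lemma consts_subring: "is_subring consts_ratfn"
  unfolding is_subring_def consts_ratfn_def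
proof (intro conjI ballI)
  show "1 \<in> {Fract (mp_const c) 1 | c. True}" by (auto simp: One_fract_def intro!: exI[of _ 1] simp: mp_const_hom)
  fix a b assume "a \<in> {Fract (mp_const c) 1 | c. True}" "b \<in> {Fract (mp_const c) 1 | c. True}"
  then obtain c d where "a = Fract (mp_const c) 1" "b = Fract (mp_const d) 1" by auto
  then have "a - b = Fract (mp_const (c - d)) 1" "a * b = Fract (mp_const (c * d)) 1"
    by (simp_all add: mp_const_hom)
  then show "a - b \<in> {Fract (mp_const c) 1 | c. True}" "a * b \<in> {Fract (mp_const c) 1 | c. True}" by auto
qed

lemma consts_inverse: "c \<in> consts_ratfn \<Longrightarrow> inverse c \<in> consts_ratfn"
proof -
  assume "c \<in> consts_ratfn"
  then obtain z where z: "c = Fract (mp_const z) 1" by (auto simp: consts_ratfn_def)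
  have "inverse c = Fract (mp_const (inverse z)) 1"
  proof (cases "z = 0")
    case True
    then show ?thesis using z by (simp add: mp_const_hom fract_collapse)
  next
    case False
    then have "mp_const z * mp_const (inverse z) = 1" by (simp flip: mp_const_hom(2) add: mp_const_hom(4))
    moreover from this have "mp_const z \<noteq> 0" by auto
    ultimately show ?thesis by (simp add: z eq_fract mult.commute)
  qed
  then show ?thesis by (auto simp: consts_ratfn_def)
qed

lemma fr_pderiv_const: "c \<in> consts_ratfn \<Longrightarrow> fr_pderiv i c = 0"
  by (auto simp: consts_ratfn_def fr_pderiv_Fract mp_pderiv_const fract_collapse)

lemma fr_pderiv_ratvar: "fr_pderiv i (ratvar j) = (if i = j then 1 else 0)"
  by (simp add: ratvar_def fr_pderiv_Fract mp_pderiv_const mp_pderiv_single lookup_single when_def fract_collapse)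

definition mp_mon :: "(nat \<Rightarrow> ratfn) \<Rightarrow> (nat \<Rightarrow>\<^sub>0 nat) \<Rightarrow> ratfn" where
  "mp_mon x m = (\<Prod>i\<in>Poly_Mapping.keys m. x i ^ Poly_Mapping.lookup m i)"

lemma mp_mon_add: "mp_mon x (m + k) = mp_mon x m * mp_mon x k"
proof -
  have *: "mp_mon x l = (\<Prod>i\<in>Poly_Mapping.keys m \<union> Poly_Mapping.keys k. x i ^ Poly_Mapping.lookup l i)"
    if "Poly_Mapping.keys l \<subseteq> Poly_Mapping.keys m \<union> Poly_Mapping.keys k" for l
    unfolding mp_mon_def using that by (intro prod.mono_neutral_left) (auto simp: in_keys_iff)
  show ?thesis
    using *[of "m + k"] *[of m] *[of k] keys_add[of m k]
    by (simp add: lookup_add power_add prod.distrib)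
qed

lemma mp_eval_single: "mp_eval (Poly_Mapping.single m c) x = Fract (mp_const c) 1 * mp_mon x m"
  by (cases "c = 0") (simp_all add: mp_eval_def mp_mon_def mp_const_hom fract_collapse)

lemma mp_eval_add: "mp_eval (p + q) x = mp_eval p x + mp_eval q x"
  unfolding mp_eval_def
  by (rule setsum_keys_plus_distrib) (simp_all only: mp_const_hom Fract_hom distrib_right mult_zero_left)

lemma mp_eval_mult: "mp_eval (p * q) x = mp_eval p x * mp_eval q x"
proof (induction p rule: mpoly_induct)
  case (single m a)
  show ?case
  proof (induction q rule: mpoly_induct)
    case (single k b)
    show ?case by (simp only: mult_single mp_eval_single mp_mon_add mp_const_hom Fract_hom mult_ac)
  qed (simp add: mp_eval_add algebra_simps)
qed (simp add: mp_eval_add algebra_simps)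

lemma mp_eval_in_subring:
  assumes S: "is_subring S" "consts_ratfn \<subseteq> S" "\<And>i. i < k \<Longrightarrow> x i \<in> S" and P: "P \<in> Apoly k"
  shows "mp_eval P x \<in> S"
  unfolding mp_eval_def
  using S P by (intro subring_sum[OF S(1)] subring_mult[OF S(1)] subring_prod[OF S(1)] subring_power[OF S(1)])
    (auto simp: consts_ratfn_def Apoly_def)

text \<open>Connects evaluation of polynomials with generated subrings, both for
  \<open>C_\<gamma>\<close> and, with \<open>x = ratvar\<close>, for the polynomial ring
  itself.\<close>

lemma subring_gen_eq_mp_eval: "subring_gen consts_ratfn (x ` {..<k}) = {mp_eval P x | P. P \<in> Apoly k}"
proof
  show "{mp_eval P x | P. P \<in> Apoly k} \<subseteq> subring_gen consts_ratfn (x ` {..<k})"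
    using subring_gen_base[of consts_ratfn "x ` {..<k}"] by (auto intro!: mp_eval_in_subring[of _ k] subring_gen_subring)
  have const: "Fract (mp_const c) 1 = mp_eval (mp_const c) x" for c
    by (simp add: mp_const_def mp_eval_single[unfolded mp_const_def] mp_mon_def)
  have var: "x i = mp_eval (Poly_Mapping.single (Poly_Mapping.single i 1) 1) x" for i
    by (simp add: mp_eval_single mp_mon_def mp_const_hom fract_collapse)
  have sub: "is_subring {mp_eval P x | P. P \<in> Apoly k}"
    unfolding is_subring_def
  proof (intro conjI ballI)
    show "1 \<in> {mp_eval P x |P. P \<in> Apoly k}"
      using const[of 1] subring_one[OF Apoly_subring] by (auto simp: mp_const_hom fract_collapse)
    fix a b assume "a \<in> {mp_eval P x |P. P \<in> Apoly k}" "b \<in> {mp_eval P x |P. P \<in> Apoly k}"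
    then obtain p q where p: "a = mp_eval p x" "b = mp_eval q x" "p \<in> Apoly k" "q \<in> Apoly k" by auto
    have "mp_eval (p - q) x = a - b" using mp_eval_add[of "p - q" q x] p by simp
    then show "a - b \<in> {mp_eval P x |P. P \<in> Apoly k}"
      using subring_diff[OF Apoly_subring p(3,4)] by force
    show "a * b \<in> {mp_eval P x |P. P \<in> Apoly k}"
      using subring_mult[OF Apoly_subring p(3,4)] p
      by (intro CollectI exI[of _ "p * q"]) (simp add: mp_eval_mult)
  qed
  show "subring_gen consts_ratfn (x ` {..<k}) \<subseteq> {mp_eval P x | P. P \<in> Apoly k}"
  proof (rule subring_gen_least[OF sub])
    show "consts_ratfn \<subseteq> {mp_eval P x | P. P \<in> Apoly k}"
      using const mp_const_Apoly by (fastforce simp: consts_ratfn_def)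
    show "x ` {..<k} \<subseteq> {mp_eval P x | P. P \<in> Apoly k}"
    proof
      fix y assume "y \<in> x ` {..<k}"
      then obtain i where i: "i < k" "y = x i" by auto
      then have "Poly_Mapping.single (Poly_Mapping.single i 1) 1 \<in> Apoly k" by (intro single_in_Apoly) auto
      then show "y \<in> {mp_eval P x | P. P \<in> Apoly k}" using var[of i] i by blast
    qed
  qed
qed

lemma single_sum_exponents:
  "finite A \<Longrightarrow> Poly_Mapping.single (\<Sum>i\<in>A. f i) (1::complex) = (\<Prod>i\<in>A. Poly_Mapping.single (f i) 1)"
proof (induction A rule: finite_induct)
  case (insert a A)
  have "Poly_Mapping.single (f a + sum f A) (1::complex) =
      Poly_Mapping.single (f a) 1 * Poly_Mapping.single (sum f A) 1"
    by (simp add: mult_single)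
  then show ?case using insert by simp
qed simp

lemma single_monomial: "Fract (Poly_Mapping.single m 1) 1 = mp_mon ratvar m"
proof -
  have 1: "Poly_Mapping.single (Poly_Mapping.single i k) (1::complex) =
      Poly_Mapping.single (Poly_Mapping.single i 1) 1 ^ k" for i :: nat and k :: nat
  proof (induction k)
    case (Suc k)
    have "Poly_Mapping.single i (Suc k) = Poly_Mapping.single i 1 + Poly_Mapping.single i k"
      by (simp flip: single_add)
    then have "Poly_Mapping.single (Poly_Mapping.single i (Suc k)) (1::complex) =
        Poly_Mapping.single (Poly_Mapping.single i 1) 1 * Poly_Mapping.single (Poly_Mapping.single i k) 1"
      by (simp add: mult_single)
    then show ?case using Suc by simp
  qed simp
  have "Poly_Mapping.single m (1::complex) =
      Poly_Mapping.single (\<Sum>i\<in>Poly_Mapping.keys m. Poly_Mapping.single i (Poly_Mapping.lookup m i)) 1"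
    by (rule arg_cong[OF mpoly_sum_single])
  also have "\<dots> = (\<Prod>i\<in>Poly_Mapping.keys m. Poly_Mapping.single (Poly_Mapping.single i (Poly_Mapping.lookup m i)) 1)"
    by (rule single_sum_exponents[OF finite_keys])
  also have "\<dots> = (\<Prod>i\<in>Poly_Mapping.keys m. Poly_Mapping.single (Poly_Mapping.single i 1) 1 ^ Poly_Mapping.lookup m i)"
    by (rule prod.cong[OF refl 1])
  finally show ?thesis
    by (simp add: Fract_prod Fract_power mp_mon_def ratvar_def)
qed

lemma mp_eval_ratvar: "mp_eval P ratvar = Fract P 1"
proof (induction P rule: mpoly_induct)
  case (single m c)
  have "Poly_Mapping.single m c = mp_const c * Poly_Mapping.single m 1"
    by (simp add: mp_const_def mult_single)
  then have "Fract (Poly_Mapping.single m c) 1 = Fract (mp_const c) 1 * Fract (Poly_Mapping.single m 1) 1"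
    by simp
  then show ?case by (simp only: mp_eval_single single_monomial)
qed (simp add: mp_eval_add)

lemma subring_gen_ratvar: "subring_gen consts_ratfn (ratvar ` {..<n}) = {Fract p 1 | p. p \<in> Apoly n}"
  by (simp add: subring_gen_eq_mp_eval mp_eval_ratvar)

section \<open>The Poisson structure\<close>

lemma deriv_on_linear_combination:
  assumes "\<And>j. deriv_on UNIV (d j)"
  shows "deriv_on UNIV (\<lambda>a. \<Sum>j\<in>A. d j a * (c j :: 'a::comm_ring_1))"
  using assms unfolding deriv_on_def
  by (simp add: distrib_right sum.distrib sum_distrib_left mult.assoc)

lemma deriv_on_inverse:
  fixes u :: "'a::field"
  assumes "deriv_on UNIV d" "u \<noteq> 0"
  shows "d (inverse u) = - d u / u\<^sup>2"
proof -
  have "0 = u * d (inverse u) + inverse u * d u"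
    using deriv_onD(3)[OF assms(1), of u "inverse u"] deriv_on_1[OF assms(1)] assms(2) by simp
  then have "u * d (inverse u) = - (inverse u * d u)" by (simp add: eq_neg_iff_add_eq_0)
  then show ?thesis using assms(2) by (simp add: field_simps power2_eq_square)
qed

lemma deriv_on_stable_subring:
  assumes d: "deriv_on UNIV d" and S: "is_subring S" and T: "is_subring T" "S \<subseteq> T"
  shows "is_subring {a \<in> S. d a \<in> T}"
  unfolding is_subring_def
proof (intro conjI ballI)
  show "1 \<in> {a \<in> S. d a \<in> T}" using deriv_on_1[OF d] subring_one[OF S] subring_zero[OF T(1)] by simp
next
  fix a b assume ab: "a \<in> {a \<in> S. d a \<in> T}" "b \<in> {a \<in> S. d a \<in> T}"
  have "d (a - b) = d a - d b" using deriv_onD(2)[OF d, of "a - b" b] by simp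
  then show "a - b \<in> {a \<in> S. d a \<in> T}" using ab subring_diff[OF S] subring_diff[OF T(1)] by auto
  show "a * b \<in> {a \<in> S. d a \<in> T}"
    using ab T by (auto simp: deriv_onD(3)[OF d] intro!: subring_mult[OF S] subring_add[OF T(1)] subring_mult[OF T(1)])
qed

lemma det_in_subring:
  assumes A: "A \<in> carrier_mat n n" and S: "is_subring S" and "\<And>i j. i < n \<Longrightarrow> j < n \<Longrightarrow> A $$ (i, j) \<in> S"
  shows "det A \<in> S"
proof -
  have sg: "(of_int (sign p) :: 'a) \<in> S" for p :: "nat \<Rightarrow> nat"
    using subring_one[OF S] subring_uminus[OF S] by (auto simp: sign_def)
  show ?thesis
    unfolding det_def'[OF A]
    using assms(3) sg by (intro subring_sum[OF S] subring_mult[OF S] subring_prod[OF S])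
      (auto simp: permutes_in_image)
qed

lemma cofactor_in_subring:
  assumes A: "A \<in> carrier_mat n n" and S: "is_subring S" and "\<And>i j. i < n \<Longrightarrow> j < n \<Longrightarrow> A $$ (i, j) \<in> S"
  shows "cofactor A i j \<in> S"
proof -
  have "det (mat_delete A i j) \<in> S"
    using A assms(3)
    by (intro det_in_subring[OF mat_delete_carrier[OF A] S]) (auto simp: mat_delete_def)
  then show ?thesis
    unfolding cofactor_def
    by (intro subring_mult[OF S] subring_power[OF S] subring_uminus[OF S] subring_one[OF S])
qed

lemma jac_det: "jac n F = det (mat n n (\<lambda>(k, i). fr_pderiv i (F k)))"
proof -
  have "(\<Prod>k<n. fr_pderiv (p k) (F k)) = (\<Prod>k = 0..<n. mat n n (\<lambda>(k, i). fr_pderiv i (F k)) $$ (k, p k))"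
    if "p permutes {0..<n}" for p
    unfolding atLeast0LessThan using permutes_in_image[OF that] by (intro prod.cong) auto
  then show ?thesis
    unfolding jac_def det_def'[OF mat_carrier] by (auto simp: atLeast0LessThan intro!: sum.cong)
qed

lemma jac_repeated:
  assumes "k < n" "l < n" "k \<noteq> l" "F k = F l"
  shows "jac n F = 0"
  unfolding jac_det
  by (rule det_identical_rows[OF mat_carrier assms(3,1,2)]) (use assms in \<open>auto intro!: eq_vecI\<close>)

text \<open>The polynomial tested is the \<open>i\<close>-th variable. Applied to the quotients
  \<open>s_i/t_i\<close>, this yields that the numerators do not vanish.\<close>

lemma alg_indep_nonzero:
  assumes "alg_indep k x" "i < k" shows "x i \<noteq> 0"
proof -
  let ?P = "Poly_Mapping.single (Poly_Mapping.single i 1) 1 :: mpoly"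
  have "Poly_Mapping.lookup ?P (Poly_Mapping.single i 1) = 1" by simp
  then have "?P \<noteq> 0" by (metis lookup_zero zero_neq_one)
  moreover have "?P \<in> Apoly k" using assms(2) by (intro single_in_Apoly) auto
  moreover have "mp_eval ?P x = x i"
    by (simp add: mp_eval_single mp_mon_def mp_const_hom fract_collapse)
  ultimately show ?thesis using assms(1) unfolding alg_indep_def by metis
qed

context affine_prime begin

lemma deriv_mod_sum: "(\<And>j. j \<in> A \<Longrightarrow> deriv_mod B (d j)) \<Longrightarrow> deriv_mod B (\<lambda>a. \<Sum>j\<in>A. d j a)"
proof (induction A rule: infinite_finite_induct)
  case (insert j A)
  then show ?case by (auto intro: deriv_mod_add)
qed (auto simp: deriv_mod_def Q_zero R_closed)

lemma deriv_mod_of_deriv: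
  assumes "deriv_on R \<delta>" "\<And>c. c \<in> K \<Longrightarrow> \<delta> c = 0"
  shows "deriv_mod R \<delta>"
  using assms by (auto simp: deriv_mod_def deriv_on_def Q_zero)

end

section \<open>The localization \<open>A_\<gamma>\<close> as a ring with coordinates\<close>

locale poisson_setting =
  fixes n :: nat and s t :: "nat \<Rightarrow> mpoly" and gam del :: "nat \<Rightarrow> bool"
  assumes n3: "n \<ge> 3"
    and s_A: "i < n - 2 \<Longrightarrow> s i \<in> Apoly n" and t_A: "i < n - 2 \<Longrightarrow> t i \<in> Apoly n"
    and t_nz: "i < n - 2 \<Longrightarrow> t i \<noteq> 0" and s_nz: "i < n - 2 \<Longrightarrow> s i \<noteq> 0"
    and dense: "i < n - 2 \<Longrightarrow> gam i \<or> del i"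
begin

abbreviation "M \<equiv> Mgam n s t gam del"
abbreviation "R \<equiv> Agam n s t gam del"
abbreviation "C \<equiv> Cgam n s t del"
abbreviation "v \<equiv> vgam s t del"
abbreviation "br \<equiv> pbr n s t"

definition "u i = Fract (s i) (t i)"

definition "inverted = (\<lambda>i. Fract 1 (s i)) ` {i. i < n - 2 \<and> gam i} \<union> (\<lambda>i. Fract 1 (t i)) ` {i. i < n - 2 \<and> del i}"

definition "gens = ratvar ` {..<n} \<union> inverted"

lemma one_M: "1 \<in> M"
  unfolding Mgam_def by (rule CollectI, rule exI[of _ "\<lambda>_. 0"], rule exI[of _ "\<lambda>_. 0"]) simp

lemma mult_M: "m \<in> M \<Longrightarrow> k \<in> M \<Longrightarrow> m * k \<in> M"
proof -
  assume "m \<in> M" "k \<in> M"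
  then obtain a b c d where m: "m = (\<Prod>i<n-2. s i ^ a i * t i ^ b i)" "k = (\<Prod>i<n-2. s i ^ c i * t i ^ d i)"
    and z: "\<forall>i<n-2. (\<not> gam i \<longrightarrow> a i = 0) \<and> (\<not> del i \<longrightarrow> b i = 0)" "\<forall>i<n-2. (\<not> gam i \<longrightarrow> c i = 0) \<and> (\<not> del i \<longrightarrow> d i = 0)"
    unfolding Mgam_def by blast
  have "m * k = (\<Prod>i<n-2. s i ^ (a i + c i) * t i ^ (b i + d i))"
    by (simp add: m power_add mult_ac flip: prod.distrib)
  then show "m * k \<in> M"
    unfolding Mgam_def using z
    by (intro CollectI exI[of _ "\<lambda>i. a i + c i"] exI[of _ "\<lambda>i. b i + d i"]) simp
qed

lemma M_Apoly: "m \<in> M \<Longrightarrow> m \<in> Apoly n"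
  unfolding Mgam_def
  by (auto intro!: subring_prod[OF Apoly_subring] subring_mult[OF Apoly_subring] subring_power[OF Apoly_subring] s_A t_A)

lemma M_nz: "m \<in> M \<Longrightarrow> m \<noteq> 0"
  unfolding Mgam_def by (auto simp: s_nz t_nz)

lemma s_M: "i < n - 2 \<Longrightarrow> gam i \<Longrightarrow> s i \<in> M"
  unfolding Mgam_def
  by (intro CollectI exI[of _ "\<lambda>j. if j = i then 1 else 0"] exI[of _ "\<lambda>_. 0"])
    (auto simp: if_distrib[of "power _"] prod.delta cong: if_cong)

lemma t_M: "i < n - 2 \<Longrightarrow> del i \<Longrightarrow> t i \<in> M"
  unfolding Mgam_def
  by (intro CollectI exI[of _ "\<lambda>_. 0"] exI[of _ "\<lambda>j. if j = i then 1 else 0"])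
    (auto simp: if_distrib[of "power _"] prod.delta cong: if_cong)

lemma in_R: "p \<in> Apoly n \<Longrightarrow> m \<in> M \<Longrightarrow> Fract p m \<in> R"
  by (auto simp: Agam_def)

lemma Apoly_R: "p \<in> Apoly n \<Longrightarrow> Fract p 1 \<in> R"
  by (rule in_R[OF _ one_M])

lemma R_E:
  assumes "x \<in> R" obtains p m where "x = Fract p m" "p \<in> Apoly n" "m \<in> M" "m \<noteq> 0"
  using assms M_nz by (auto simp: Agam_def)

lemma R_subring: "is_subring R"
  unfolding is_subring_def
proof (intro conjI ballI)
  show "1 \<in> R" using in_R[OF subring_one[OF Apoly_subring] one_M] by (simp add: fract_collapse)
  fix x y assume "x \<in> R" "y \<in> R"
  then obtain p m q k where x: "x = Fract p m" "p \<in> Apoly n" "m \<in> M" "m \<noteq> 0"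
    and y: "y = Fract q k" "q \<in> Apoly n" "k \<in> M" "k \<noteq> 0" by (metis R_E)
  have "x - y = Fract (p * k - q * m) (m * k)" using x y by simp
  then show "x - y \<in> R"
    using x y M_Apoly[OF x(3)] M_Apoly[OF y(3)]
    by (auto intro!: in_R mult_M subring_diff[OF Apoly_subring] subring_mult[OF Apoly_subring])
  show "x * y \<in> R"
    using x y by (auto intro!: in_R mult_M subring_mult[OF Apoly_subring])
qed

lemma fr_pderiv_R: "x \<in> R \<Longrightarrow> fr_pderiv i x \<in> R"
proof (erule R_E)
  fix p m assume x: "x = Fract p m" "p \<in> Apoly n" "m \<in> M" "m \<noteq> 0"
  then show ?thesis
    using M_Apoly[OF x(3)]
    by (auto simp: fr_pderiv_Fract intro!: in_R mult_M subring_diff[OF Apoly_subring]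
      subring_mult[OF Apoly_subring] mp_pderiv_Apoly)
qed

lemma fr_pderiv_deriv_R: "deriv_on R (fr_pderiv i)"
  using fr_pderiv_deriv[of i] fr_pderiv_R by (auto simp: deriv_on_def)

lemma consts_R: "consts_ratfn \<subseteq> R"
  by (auto simp: consts_ratfn_def intro!: Apoly_R mp_const_Apoly)

lemma ratvar_R: "i < n \<Longrightarrow> ratvar i \<in> R"
  unfolding ratvar_def by (intro Apoly_R single_in_Apoly) auto

lemma inverse_M_R: "m \<in> M \<Longrightarrow> inverse (Fract m 1) \<in> R"
  by (simp add: in_R subring_one[OF Apoly_subring])

lemma subring_gen_gens: "subring_gen consts_ratfn gens = R"
proof
  have "inverted \<subseteq> R"
    using s_M t_M by (auto simp: inverted_def intro!: in_R subring_one[OF Apoly_subring])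
  then show "subring_gen consts_ratfn gens \<subseteq> R"
    using ratvar_R consts_R by (intro subring_gen_least R_subring) (auto simp: gens_def)
  show "R \<subseteq> subring_gen consts_ratfn gens"
  proof
    fix x assume "x \<in> R"
    then obtain p m where x: "x = Fract p m" "p \<in> Apoly n" "m \<in> M" by (metis R_E)
    have "Fract p 1 \<in> subring_gen consts_ratfn (ratvar ` {..<n})" using x by (auto simp: subring_gen_ratvar)
    then have p: "Fract p 1 \<in> subring_gen consts_ratfn gens"
      using subring_gen_mono[of "ratvar ` {..<n}" gens] by (auto simp: gens_def)
    obtain a b where m: "m = (\<Prod>i<n-2. s i ^ a i * t i ^ b i)"
      and z: "\<And>i. i < n - 2 \<Longrightarrow> (\<not> gam i \<longrightarrow> a i = 0) \<and> (\<not> del i \<longrightarrow> b i = 0)"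
      using x(3) unfolding Mgam_def by blast
    have "inverse (Fract m 1) = (\<Prod>i<n-2. inverse (Fract (s i) 1) ^ a i * inverse (Fract (t i) 1) ^ b i)"
      unfolding m Fract_prod Fract_hom Fract_power prod_inversef[symmetric]
      by (simp add: power_inverse del: inverse_fract mult_fract)
    also have "\<dots> \<in> subring_gen consts_ratfn gens"
    proof (intro subring_prod[OF subring_gen_subring] subring_mult[OF subring_gen_subring])
      fix i assume i: "i \<in> {..<n-2}"
      note g = subring_gen_base[of consts_ratfn gens]
      show "inverse (Fract (s i) 1) ^ a i \<in> subring_gen consts_ratfn gens"
        using i z[of i] g subring_one[OF subring_gen_subring]
        by (cases "gam i") (auto simp: gens_def inverted_def intro!: subring_power[OF subring_gen_subring])
      show "inverse (Fract (t i) 1) ^ b i \<in> subring_gen consts_ratfn gens"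
        using i z[of i] g subring_one[OF subring_gen_subring]
        by (cases "del i") (auto simp: gens_def inverted_def intro!: subring_power[OF subring_gen_subring])
    qed
    finally have "Fract p 1 * inverse (Fract m 1) \<in> subring_gen consts_ratfn gens"
      by (rule subring_mult[OF subring_gen_subring p])
    then show "x \<in> subring_gen consts_ratfn gens" by (simp add: x)
  qed
qed

sublocale A: affine_coords consts_ratfn R gens n ratvar fr_pderiv
proof
  show "is_subring consts_ratfn" by (rule consts_subring)
  show "inverse c \<in> consts_ratfn" if "c \<in> consts_ratfn" for c using that by (rule consts_inverse)
  show "is_subring R" by (rule R_subring)
  show "finite gens" by (simp add: gens_def inverted_def)
  show "subring_gen consts_ratfn gens = R" by (rule subring_gen_gens)
  show "ratvar i \<in> R" if "i < n" for i using that by (rule ratvar_R)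
  show "deriv_on R (fr_pderiv i)" for i by (rule fr_pderiv_deriv_R)
  show "fr_pderiv i c = 0" if "c \<in> consts_ratfn" for i c using that by (rule fr_pderiv_const)
  show "fr_pderiv i (ratvar j) = (if i = j then 1 else 0)" for i j by (rule fr_pderiv_ratvar)
  fix a assume "a \<in> R"
  then obtain p m where a: "a = Fract p m" "p \<in> Apoly n" "m \<in> M" "m \<noteq> 0" by (rule R_E)
  have "Fract m 1 \<noteq> 0" "a * Fract m 1 = Fract p 1" using a by (simp_all add: Zero_fract_def eq_fract)
  then show "\<exists>m\<in>subring_gen consts_ratfn (ratvar ` {..<n}).
      m \<noteq> 0 \<and> inverse m \<in> R \<and> a * m \<in> subring_gen consts_ratfn (ratvar ` {..<n})"
    unfolding subring_gen_ratvar using a M_Apoly[OF a(3)] inverse_M_R[OF a(3)] by blast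
qed

section \<open>The subalgebra \<open>C_\<gamma>\<close> and the bracket as a determinant\<close>

lemma C_gen: "C = subring_gen consts_ratfn (v ` {..<n-2})"
  by (simp add: subring_gen_eq_mp_eval Cgam_def)

lemma u_nz: "i < n - 2 \<Longrightarrow> u i \<noteq> 0"
  using s_nz t_nz by (simp add: u_def Zero_fract_def eq_fract)

lemma v_u: "v i = (if del i then u i else inverse (u i))"
  by (simp add: vgam_def u_def)

lemma v_R: "i < n - 2 \<Longrightarrow> v i \<in> R"
  using dense s_M t_M s_A t_A by (auto simp: vgam_def intro!: in_R)

lemma C_R: "C \<subseteq> R"
  unfolding C_gen using v_R by (intro subring_gen_least R_subring consts_R) auto

text \<open>The Jacobian matrix with the factor \<open>(t_1 ... t_(n-2))^2\<close> distributed over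
  its last \<open>n - 2\<close> rows. Each \<open>t_i^2\<close> clears the denominator of the
  gradient of \<open>s_i/t_i\<close>, so for \<open>f, g\<close> in \<open>A_\<gamma>\<close> all
  entries lie in \<open>A_\<gamma>\<close>.\<close>

definition W :: "ratfn \<Rightarrow> ratfn \<Rightarrow> ratfn mat" where
  "W f g = mat n n (\<lambda>(k, i). if k = 0 then fr_pderiv i f else if k = 1 then fr_pderiv i g
     else (Fract (t (k - 2)) 1)\<^sup>2 * fr_pderiv i (u (k - 2)))"

lemma W_carrier: "W f g \<in> carrier_mat n n"
  by (simp add: W_def)

lemma br_det: "br f g = det (W f g)"
proof -
  define m where "m = n - 2"
  have n: "n = Suc (Suc m)" using n3 by (simp add: m_def)
  define r where "r k = (if k < 2 then 1 else (Fract (t (k - 2)) 1)\<^sup>2)" for k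
  define F where "F k = (if k = 0 then f else if k = 1 then g else Fract (s (k-2)) (t (k-2)))" for k
  have "(\<Prod>k<n. r k) = (\<Prod>k<m. (Fract (t k) 1)\<^sup>2)"
    by (simp add: n r_def prod.lessThan_Suc_shift del: prod.lessThan_Suc)
  also have "\<dots> = (Fract (\<Prod>i<n-2. t i) 1)\<^sup>2"
    unfolding Fract_prod m_def by (simp add: prod_power_distrib)
  finally have r: "(\<Prod>k<n. r k) = (Fract (\<Prod>i<n-2. t i) 1)\<^sup>2" .
  have "(\<Prod>k = 0..<n. W f g $$ (k, p k)) = (\<Prod>k<n. r k) * (\<Prod>k<n. fr_pderiv (p k) (F k))"
    if "p permutes {0..<n}" for p
    unfolding atLeast0LessThan prod.distrib[symmetric] using permutes_in_image[OF that]
    by (intro prod.cong) (auto simp: W_def r_def F_def u_def)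
  then show ?thesis
    unfolding det_def'[OF W_carrier] pbr_def jac_def F_def[symmetric] r sum_distrib_left
    by (auto simp: atLeast0LessThan mult_ac intro!: sum.cong)
qed

text \<open>Expansion along the first row. The cofactors do not depend on \<open>f\<close>, whose
  place is taken by 0, so the bracket is visibly a derivation in its first argument.\<close>

lemma br_left: "br f g = (\<Sum>j<n. fr_pderiv j f * cofactor (W 0 g) 0 j)"
proof -
  have n: "0 < n" using n3 by simp
  have "cofactor (W f g) 0 j = cofactor (W 0 g) 0 j" for j
  proof -
    have "mat_delete (W f g) 0 j = mat_delete (W 0 g) 0 j"
      unfolding mat_delete_def by (rule eq_matI) (auto simp: W_def)
    then show ?thesis by (simp add: cofactor_def)
  qed
  then show ?thesis
    unfolding br_det laplace_expansion_row[OF W_carrier n] using n by (auto simp: W_def intro!: sum.cong)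
qed

lemma br_deriv: "deriv_on UNIV (\<lambda>f. br f g)"
  unfolding br_left by (rule deriv_on_linear_combination[OF fr_pderiv_deriv])

lemma br_anti: "br g f = - br f g"
proof -
  have n: "0 < n" "1 < n" using n3 by auto
  have "swaprows 0 1 (W f g) = W g f"
    using n by (intro eq_matI) (auto simp: W_def)
  then show ?thesis
    unfolding br_det using det_swaprows[OF n _ W_carrier[of f g]] by simp
qed

lemma br_self: "br f f = 0"
proof -
  have "2 * br f f = 0" using br_anti[of f f] by (metis add.right_inverse mult_2)
  then show ?thesis by simp
qed

lemma br_const: "c \<in> consts_ratfn \<Longrightarrow> br c g = 0"
  by (simp add: br_left fr_pderiv_const)

lemma br_u:
  assumes "i < n - 2" shows "br (u i) g = 0"
proof -
  have "jac n (\<lambda>k. if k = 0 then u i else if k = 1 then g else Fract (s (k - 2)) (t (k - 2))) = 0"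
    by (rule jac_repeated[of 0 _ "i + 2"]) (use assms in \<open>auto simp: u_def\<close>)
  then show ?thesis by (simp add: pbr_def)
qed

text \<open>Bracketing with \<open>s_i/t_i\<close> repeats a row of the Jacobian. The kernel of a
  derivation is a subring, and it contains the inverse of each of its nonzero elements.\<close>

lemma br_central:
  assumes "c \<in> C" shows "br c g = 0"
proof -
  have "br (v i) g = 0" if "i < n - 2" for i
    using br_u[OF that, of g] deriv_on_inverse[OF br_deriv u_nz[OF that], of g] by (simp add: v_u)
  then have "subring_gen consts_ratfn (v ` {..<n-2}) \<subseteq> {a \<in> UNIV. br a g = 0}"
    by (intro subring_gen_least deriv_on_kernel_subring br_deriv) (auto simp: br_const is_subring_def)
  then show ?thesis using assms by (auto simp: C_gen)
qed

lemma u_scaled_R: "i < n - 2 \<Longrightarrow> (Fract (t i) 1)\<^sup>2 * fr_pderiv j (u i) \<in> R"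
proof -
  assume i: "i < n - 2"
  have "(Fract (t i) 1)\<^sup>2 * fr_pderiv j (u i) = Fract (mp_pderiv j (s i) * t i - s i * mp_pderiv j (t i)) 1"
    using t_nz[OF i] by (simp add: u_def fr_pderiv_Fract power2_eq_square eq_fract mult_ac)
  then show ?thesis
    using i by (auto intro!: Apoly_R subring_diff[OF Apoly_subring] subring_mult[OF Apoly_subring] mp_pderiv_Apoly s_A t_A)
qed

lemma W_R: "f \<in> R \<Longrightarrow> g \<in> R \<Longrightarrow> i < n \<Longrightarrow> j < n \<Longrightarrow> W f g $$ (i, j) \<in> R"
  by (auto simp: W_def fr_pderiv_R intro!: u_scaled_R)

lemma br_R: "f \<in> R \<Longrightarrow> g \<in> R \<Longrightarrow> br f g \<in> R"
  unfolding br_det by (rule det_in_subring[OF W_carrier R_subring W_R])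

lemma br_deriv_R: "g \<in> R \<Longrightarrow> deriv_on R (\<lambda>f. br f g)"
  using br_deriv[of g] br_R by (auto simp: deriv_on_def)

text \<open>The factor relating the rows of \<open>W\<close> to the gradients of the
  \<open>v_i\<close>. For \<open>v_i = t_i/s_i\<close> the sign and the square of \<open>s_i\<close>
  come from the derivative \<open>- \<partial>u / u^2\<close> of \<open>1/u\<close>.\<close>

definition "\<rho> i = (if del i then (Fract (t i) 1)\<^sup>2 else - (Fract (s i) 1)\<^sup>2)"

lemma \<rho>_R: "i < n - 2 \<Longrightarrow> \<rho> i \<in> R"
  by (auto simp: \<rho>_def intro!: subring_uminus[OF R_subring] subring_power[OF R_subring] Apoly_R s_A t_A)

lemma \<rho>_nz: "i < n - 2 \<Longrightarrow> \<rho> i \<noteq> 0"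
proof -
  assume "i < n - 2"
  then have "Fract (s i) 1 \<noteq> 0" "Fract (t i) 1 \<noteq> 0"
    using s_nz t_nz by (simp_all add: Zero_fract_def eq_fract)
  then show ?thesis by (simp add: \<rho>_def)
qed

lemma W_row:
  assumes "i < n - 2" "j < n"
  shows "W f g $$ (i + 2, j) = \<rho> i * fr_pderiv j (v i)"
proof -
  have "\<rho> i * fr_pderiv j (v i) = (Fract (t i) 1)\<^sup>2 * fr_pderiv j (u i)"
  proof (cases "del i")
    case False
    have "\<rho> i * fr_pderiv j (v i) = ((Fract (s i) 1)\<^sup>2 / (u i)\<^sup>2) * fr_pderiv j (u i)"
      using False by (simp add: \<rho>_def v_u deriv_on_inverse[OF fr_pderiv_deriv u_nz[OF assms(1)]])
    also have "(Fract (s i) 1)\<^sup>2 / (u i)\<^sup>2 = (Fract (t i) 1)\<^sup>2"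
      using s_nz[OF assms(1)] t_nz[OF assms(1)]
      by (simp add: u_def power2_eq_square eq_fract)
    finally show ?thesis .
  qed (simp add: \<rho>_def v_u)
  then show ?thesis using assms by (simp add: W_def)
qed

section \<open>Cramer's rule for the Jacobian matrix and its consequences\<close>

lemma adj_sums:
  assumes "i < n" "j < n"
  shows "(\<Sum>k<n. adj_mat (W f g) $$ (i, k) * W f g $$ (k, j)) = (if i = j then br f g else 0)"
    and "(\<Sum>k<n. W f g $$ (i, k) * adj_mat (W f g) $$ (k, j)) = (if i = j then br f g else 0)"
proof -
  note adj = adj_mat[OF W_carrier[of f g]]
  have d: "dim_row (W f g) = n" "dim_col (W f g) = n" "dim_row (adj_mat (W f g)) = n" "dim_col (adj_mat (W f g)) = n"
    using W_carrier[of f g] adj(1) by auto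
  have "(adj_mat (W f g) * W f g) $$ (i, j) = (if i = j then br f g else 0)"
    "(W f g * adj_mat (W f g)) $$ (i, j) = (if i = j then br f g else 0)"
    unfolding adj br_det using assms by simp_all
  then show "(\<Sum>k<n. adj_mat (W f g) $$ (i, k) * W f g $$ (k, j)) = (if i = j then br f g else 0)"
    "(\<Sum>k<n. W f g $$ (i, k) * adj_mat (W f g) $$ (k, j)) = (if i = j then br f g else 0)"
    using assms d by (simp_all add: scalar_prod_def atLeast0LessThan)
qed

lemma adj_R: "f \<in> R \<Longrightarrow> g \<in> R \<Longrightarrow> i < n \<Longrightarrow> j < n \<Longrightarrow> adj_mat (W f g) $$ (i, j) \<in> R"
  using W_carrier[of f g] cofactor_in_subring[OF W_carrier R_subring W_R, of f g j i] by (simp add: adj_mat_def)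

text \<open>A nonzero bracket makes \<open>W f g\<close> invertible over the rational functions, and
  the columns of its inverse are vector fields dual to its rows. Those belonging to the
  \<open>v_k\<close> turn \<open>C_\<gamma>\<close> into a ring with coordinates.\<close>

lemma C_derivations:
  assumes "br f g \<noteq> 0"
  obtains \<delta> where "\<And>k. deriv_on UNIV (\<delta> k)" "\<And>k c. c \<in> consts_ratfn \<Longrightarrow> \<delta> k c = 0"
    "\<And>k j. k < n - 2 \<Longrightarrow> j < n - 2 \<Longrightarrow> \<delta> k (v j) = (if k = j then 1 else 0)"
proof -
  \<comment> \<open>The index \<open>k + 2\<close> skips the rows of \<open>f\<close> and
    \<open>g\<close>. Dividing by the determinant and multiplying by \<open>\<rho> k\<close>
    normalizes the value at \<open>v k\<close> to 1.\<close>
  define \<delta> where "\<delta> k a = (\<Sum>i<n. fr_pderiv i a * (adj_mat (W f g) $$ (i, k + 2) * (\<rho> k / br f g)))" for k a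
  have "deriv_on UNIV (\<delta> k)" for k
    unfolding \<delta>_def by (rule deriv_on_linear_combination[OF fr_pderiv_deriv])
  moreover have "\<delta> k c = 0" if "c \<in> consts_ratfn" for k c
    using that by (simp add: \<delta>_def fr_pderiv_const)
  moreover have "\<delta> k (v j) = (if k = j then 1 else 0)" if "k < n - 2" "j < n - 2" for k j
  proof -
    have "\<rho> j * \<delta> k (v j) =
        (\<Sum>i<n. W f g $$ (j + 2, i) * adj_mat (W f g) $$ (i, k + 2)) * (\<rho> k / br f g)"
      unfolding \<delta>_def sum_distrib_left sum_distrib_right
      by (rule sum.cong) (use W_row[OF that(2)] in simp_all)
    also have "\<dots> = (if k = j then \<rho> j else 0)"
      using adj_sums(2)[of "j + 2" "k + 2"] that assms by auto
    finally show ?thesis using \<rho>_nz[OF that(2)] by (auto split: if_splits)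
  qed
  ultimately show thesis by (rule that)
qed

text \<open>Cramer's rule modulo \<open>Q\<close>, applied to the system \<open>D a = (\<Sum>i. D x_i * \<partial>_i a)\<close>.\<close>

lemma derivation_determined:
  assumes Q: "prime_in R Q" and fg: "f \<in> R" "g \<in> R" "br f g \<notin> Q"
    and D: "affine_prime.deriv_mod consts_ratfn R Q R D" "D f \<in> Q" "D g \<in> Q" "\<And>k. k < n - 2 \<Longrightarrow> D (v k) \<in> Q"
    and i: "i < n"
  shows "D (ratvar i) \<in> Q"
proof -
  interpret affine_prime consts_ratfn R gens Q by (rule A.prime_affine[OF Q])
  define w where "w j = D (ratvar j)" for j
  have wR: "w j \<in> R" if "j < n" for j using deriv_modD(1)[OF D(1) ratvar_R[OF that]] by (simp add: w_def)
  \<comment> \<open>Subtracting this combination of partial derivatives makes \<open>E\<close>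
    vanish at every coordinate, hence modulo \<open>Q\<close> on all of \<open>R\<close>; this is
    the linear system to be solved.\<close>
  define E where "E a = D a + (\<Sum>j<n. (- w j) * fr_pderiv j a)" for a
  have E: "deriv_mod R E"
    unfolding E_def using wR
    by (intro deriv_mod_add D(1) deriv_mod_sum deriv_mod_scale deriv_mod_of_deriv fr_pderiv_deriv_R fr_pderiv_const) (auto intro: R_closed)
  have "E a \<in> Q" if "a \<in> R" for a
  proof (rule A.deriv_mod_vanish_coords[OF Q E _ that])
    fix i assume "i < n"
    then have "(\<Sum>j<n. - w j * fr_pderiv j (ratvar i)) = - w i"
      by (simp add: fr_pderiv_ratvar if_distrib cong: if_cong)
    then have "E (ratvar i) = 0" by (simp add: E_def w_def)
    then show "E (ratvar i) \<in> Q" by (simp add: Q_zero)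
  qed
  then have lin: "(\<Sum>j<n. fr_pderiv j a * w j) \<in> Q" if "a \<in> R" "D a \<in> Q" for a
    using Q_diff[OF that(2), of "E a"] that(1) by (simp add: E_def sum_negf mult.commute)
  have row: "(\<Sum>j<n. W f g $$ (k, j) * w j) \<in> Q" if "k < n" for k
  proof -
    have "k = 0 \<or> k = 1 \<or> (k = (k - 2) + 2 \<and> k - 2 < n - 2)" using that by linarith
    then consider "k = 0" | "k = 1" | l where "k = l + 2" "l < n - 2" by blast
    then show ?thesis
    proof cases
      case 1
      then show ?thesis using lin[OF fg(1) D(2)] n3 by (simp add: W_def)
    next
      case 2
      then show ?thesis using lin[OF fg(2) D(3)] n3 by (simp add: W_def)
    next
      case 3
      have "(\<Sum>j<n. W f g $$ (k, j) * w j) = \<rho> l * (\<Sum>j<n. fr_pderiv j (v l) * w j)"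
        unfolding sum_distrib_left 3(1) by (rule sum.cong) (use W_row[OF 3(2)] in \<open>simp_all add: mult.assoc\<close>)
      then show ?thesis using Q_mult[OF \<rho>_R[OF 3(2)] lin[OF v_R[OF 3(2)] D(4)[OF 3(2)]]] by simp
    qed
  qed
  have "(\<Sum>k<n. adj_mat (W f g) $$ (i, k) * (\<Sum>j<n. W f g $$ (k, j) * w j)) =
      (\<Sum>j<n. (\<Sum>k<n. adj_mat (W f g) $$ (i, k) * W f g $$ (k, j)) * w j)"
    unfolding sum_distrib_left sum_distrib_right by (subst sum.swap) (simp add: mult.assoc)
  also have "\<dots> = (\<Sum>j<n. if i = j then br f g * w j else 0)"
    using adj_sums(1)[OF i] by (intro sum.cong) auto
  also have "\<dots> = br f g * w i" using i by simp
  finally have "br f g * w i \<in> Q"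
    using row adj_R[OF fg(1,2) i] by (metis (no_types, lifting) Q_mult Q_sum lessThan_iff)
  then show ?thesis using Q_cancel br_R[OF fg(1,2)] wR[OF i] fg(3) by (auto simp: w_def)
qed

text \<open>A derivation killing \<open>E\<close> also kills every \<open>v k\<close>, which lies in
  the closure of \<open>E\<close>. If it kills \<open>f\<close> and \<open>g\<close> too, Cramer's
  rule makes it vanish on all coordinates.\<close>

lemma spanning:
  assumes Q: "prime_in R Q" and fg: "f \<in> R" "g \<in> R" "br f g \<notin> Q"
    and v: "\<And>k. k < n - 2 \<Longrightarrow> v k \<in> affine_prime.cl consts_ratfn R Q E"
  shows "R \<subseteq> affine_prime.cl consts_ratfn R Q (insert f (insert g E))"
proof
  interpret affine_prime consts_ratfn R gens Q by (rule A.prime_affine[OF Q])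
  fix a assume a: "a \<in> R"
  show "a \<in> cl (insert f (insert g E))"
    unfolding cl_def
  proof (intro CollectI conjI a allI impI)
    fix D assume D: "deriv_quot R D" "\<forall>x\<in>insert f (insert g E). D x \<in> Q"
    have dm: "deriv_mod R D" using D(1) unfolding deriv_quot_def by blast
    have dv: "D (v k) \<in> Q" if "k < n - 2" for k using v[OF that] D by (simp add: cl_def)
    have "D f \<in> Q" "D g \<in> Q" using D(2) by auto
    from derivation_determined[OF Q fg dm this dv]
    show "D a \<in> Q" by (rule A.deriv_mod_vanish_coords[OF Q dm _ a])
  qed
qed

section \<open>Minimal primes over central ideals, and proper Poisson primes\<close>

lemma minimal_prime_poisson:
  assumes I: "ideal_in C I" and Q: "minimal_prime_over R (ideal_gen R I) Q"
  shows "poisson_prime R br Q"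
proof -
  have pr: "prime_in R Q" using Q by (simp add: minimal_prime_over_def)
  interpret affine_prime consts_ratfn R gens Q by (rule A.prime_affine[OF pr])
  define J where "J = ideal_gen R I"
  have IC: "I \<subseteq> C" using I by (simp add: ideal_in_def)
  have J_ideal: "ideal_in R J"
    unfolding J_def ideal_gen_def ideal_in_def
    using IC C_R R_closed by (auto simp: ideal_in_def intro!: exI[of _ R])
  have IJ: "I \<subseteq> J" by (auto simp: J_def ideal_gen_def)
  have stable: "br a b \<in> J" if "a \<in> J" "b \<in> R" for a b
  proof -
    \<comment> \<open>By the Leibniz rule the elements of \<open>J\<close> whose bracket with
      \<open>b\<close> stays in \<open>J\<close> form an ideal. It contains the central set
      \<open>I\<close>, hence all of \<open>J\<close>.\<close>
    have "ideal_in R {a \<in> J. br a b \<in> J}"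
      unfolding ideal_in_def
    proof (intro conjI ballI)
      note d = br_deriv[of b]
      show "{a \<in> J. br a b \<in> J} \<subseteq> R" using J_ideal by (auto simp: ideal_in_def)
      show "0 \<in> {a \<in> J. br a b \<in> J}" using J_ideal deriv_on_0[OF d] by (auto simp: ideal_in_def)
      show "x + y \<in> {a \<in> J. br a b \<in> J}" if "x \<in> {a \<in> J. br a b \<in> J}" "y \<in> {a \<in> J. br a b \<in> J}" for x y
        using that J_ideal deriv_onD(2)[OF d] by (auto simp: ideal_in_def)
      show "r * x \<in> {a \<in> J. br a b \<in> J}" if "r \<in> R" "x \<in> {a \<in> J. br a b \<in> J}" for r x
        using that J_ideal br_R[OF that(1) \<open>b \<in> R\<close>] deriv_onD(3)[OF d, of r x]
        by (auto simp: ideal_in_def mult.commute[of x])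
    qed
    moreover have "I \<subseteq> {a \<in> J. br a b \<in> J}"
      using IJ IC br_central J_ideal by (auto simp: ideal_in_def)
    ultimately have "J \<subseteq> {a \<in> J. br a b \<in> J}" unfolding J_def ideal_gen_def by blast
    then show ?thesis using that by auto
  qed
  have "br a b \<in> Q" if "a \<in> Q" "b \<in> R" for a b
  proof -
    define \<delta> where "\<delta> = (\<lambda>x. br x b)"
    have d: "deriv_on R \<delta>" unfolding \<delta>_def by (rule br_deriv_R[OF that(2)])
    have "(\<delta> ^^ k) a \<in> J" if "a \<in> J" for k a
      using that stable \<open>b \<in> R\<close> by (induction k) (auto simp: \<delta>_def)
    then have "J \<subseteq> diff_core \<delta> R Q"
      using Q J_ideal by (auto simp: diff_core_def minimal_prime_over_def J_def ideal_in_def)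
    \<comment> \<open>The core is a prime ideal between \<open>J\<close> and \<open>Q\<close>, so
      minimality makes it equal to \<open>Q\<close>, and \<open>Q\<close> inherits its
      stability.\<close>
    then have "diff_core \<delta> R Q = Q"
      using Q diff_core_prime[OF d] diff_core_subset unfolding minimal_prime_over_def J_def by blast
    then show ?thesis using diff_core_stable[OF d, of a Q] diff_core_subset that(1) by (auto simp: \<delta>_def)
  qed
  then show ?thesis using pr by (simp add: poisson_prime_def)
qed

lemma proper_poisson_prime:
  assumes Q: "poisson_prime R br Q" "proper_pp R br Q"
  shows "height_in R Q = height_in C (Q \<inter> C) \<and> minimal_prime_over R (ideal_gen R (Q \<inter> C)) Q"
proof -
  obtain f g where fg: "f \<in> R" "g \<in> R" "br f g \<notin> Q" using Q(2) by (auto simp: proper_pp_def)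
  have prQ: "prime_in R Q" and pois: "\<And>a b. a \<in> Q \<Longrightarrow> b \<in> R \<Longrightarrow> br a b \<in> Q"
    using Q(1) by (auto simp: poisson_prime_def)
  interpret Q: affine_prime consts_ratfn R gens Q by (rule A.prime_affine[OF prQ])
  have "br f g \<noteq> 0" using fg Q.Q_zero by auto
  then obtain \<delta> where \<delta>: "\<And>k. deriv_on UNIV (\<delta> k)" "\<And>k c. c \<in> consts_ratfn \<Longrightarrow> \<delta> k c = 0"
    "\<And>k j. k < n - 2 \<Longrightarrow> j < n - 2 \<Longrightarrow> \<delta> k (v j) = (if k = j then 1 else 0)"
    using C_derivations by metis
  have Csub: "is_subring C" unfolding C_gen by (rule subring_gen_subring)
  have vC: "v ` {..<n-2} \<subseteq> C" "consts_ratfn \<subseteq> C" unfolding C_gen using subring_gen_base[of consts_ratfn "v ` {..<n-2}"] by simp_all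
  have \<delta>C: "deriv_on C (\<delta> k)" if "k < n - 2" for k
  proof -
    \<comment> \<open>\<open>\<delta> k\<close> was built over the rational functions, but it sends
      each generator of \<open>C\<close> to 0 or 1 and so preserves \<open>C\<close>.\<close>
    have "C \<subseteq> {a \<in> C. \<delta> k a \<in> C}"
      unfolding C_gen using vC \<delta> that subring_zero[OF Csub] subring_one[OF Csub]
      by (intro subring_gen_least deriv_on_stable_subring subring_gen_subring order_refl) (auto simp flip: C_gen)
    then show ?thesis using \<delta>(1)[of k] by (auto simp: deriv_on_def)
  qed
  interpret C: affine_coords consts_ratfn C "v ` {..<n-2}" "n - 2" v \<delta>
  proof
    show "\<exists>m\<in>subring_gen consts_ratfn (v ` {..<n-2}). m \<noteq> 0 \<and> inverse m \<in> C \<and> a * m \<in> subring_gen consts_ratfn (v ` {..<n-2})"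
      if "a \<in> C" for a
      using that subring_one[OF Csub] unfolding C_gen by (intro bexI[of _ 1]) auto
  qed (use Csub vC \<delta> \<delta>C in \<open>auto simp: C_gen[symmetric] consts_subring consts_inverse\<close>)
  define P where "P = Q \<inter> C"
  have prP: "prime_in C P"
    using prQ Csub C_R Q.one_notin_Q subring_one[OF Csub]
    by (auto simp: P_def prime_in_def ideal_in_def subset_iff subring_intros)
  note affP = C.prime_affine[OF prP]
  interpret P: affine_prime consts_ratfn C "v ` {..<n-2}" P by (rule affP)
  obtain E where E: "E \<subseteq> v ` {..<n-2}" "P.indep E" "v ` {..<n-2} \<subseteq> P.cl E"
    using P.basis_exists[OF _ vC(1)] by blast
  have finE: "finite E" and EC: "E \<subseteq> C" using E(1) vC finite_subset by blast+
  have "P.cl E = C" using P.cl_closed[OF E(3)] C.cl_coords[OF prP] P.cl_R by auto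
  then have htP: "height_in C P = enat (n - 2 - card E)"
    using C.height_formula[OF prP finE E(2)] by auto
  \<comment> \<open>Stated for every prime with the same trace on \<open>C\<close> as
    \<open>Q\<close>, because it is used again for the smaller prime \<open>P'\<close>.\<close>
  have vcl: "v k \<in> affine_prime.cl consts_ratfn R Q' E" if "prime_in R Q'" "P = Q' \<inter> C" "k < n - 2" for Q' k
    using cl_restrict[OF affP A.prime_affine[OF that(1)] C_R that(2) EC, of "v k"] E(3) vC that(3) by auto
  have indE: "Q.indep E"
    by (rule indep_restrict[OF affP A.prime_affine[OF prQ] C_R P_def E(2)])
  have ham: "Q.deriv_quot R (\<lambda>a. br a b)" if "b \<in> R" for b
    unfolding Q.deriv_quot_def using pois that
    by (auto intro!: Q.deriv_mod_of_deriv br_deriv_R simp: br_const)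
  have killE: "\<forall>c\<in>E. br c b \<in> Q" for b using EC br_central Q.Q_zero by (metis subsetD)
  \<comment> \<open>The Hamiltonian derivation of \<open>f\<close> kills \<open>E\<close> but not
    \<open>g\<close>. In the next claim that of \<open>g\<close> kills both \<open>E\<close> and
    \<open>g\<close> but not \<open>f\<close>.\<close>
  have gcl: "g \<notin> Q.cl E"
  proof
    assume "g \<in> Q.cl E"
    then have "br g f \<in> Q" using ham[OF fg(1)] killE[of f] unfolding Q.cl_def by blast
    then show False using fg(3) Q.Q_uminus[of "br g f"] br_anti[of f g] by simp
  qed
  have fcl: "f \<notin> Q.cl (insert g E)"
  proof
    assume "f \<in> Q.cl (insert g E)"
    moreover have "\<forall>c\<in>insert g E. br c g \<in> Q" using killE br_self Q.Q_zero by auto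
    ultimately have "br f g \<in> Q" using ham[OF fg(2)] unfolding Q.cl_def by blast
    then show False using fg(3) by simp
  qed
  let ?S = "insert f (insert g E)"
  have indS: "Q.indep ?S" using gcl fcl fg indE by (intro Q.indep_insert) auto
  have "g \<notin> E" "f \<notin> insert g E"
    using gcl fcl Q.cl_extensive[of E] Q.cl_extensive[of "insert g E"] EC C_R fg by auto
  then have cardS: "card ?S = card E + 2" using finE by simp
  have "height_in R Q = enat (n - card ?S)"
    using A.height_formula[OF prQ _ indS spanning[OF prQ fg vcl[OF prQ P_def]]] finE by simp
  then have ht: "height_in R Q = height_in C P" using htP cardS by (simp add: diff_diff_left add.commute)
  \<comment> \<open>\<open>P'\<close> has the same trace on \<open>C\<close> as \<open>Q\<close>,
    and \<open>br f g\<close> lies outside \<open>P'\<close>, so \<open>f\<close>, \<open>g\<close>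
    and \<open>E\<close> span modulo \<open>P'\<close> as well. A strict inclusion would yield an
    independent set with one element more than this spanning set.\<close>
  have "P' = Q" if P': "prime_in R P'" "ideal_gen R P \<subseteq> P'" "P' \<subseteq> Q" for P'
  proof (rule ccontr)
    assume "P' \<noteq> Q"
    then have "P' \<subset> Q" using P' by auto
    interpret P': affine_prime consts_ratfn R gens P' by (rule A.prime_affine[OF P'(1)])
    have "P \<subseteq> ideal_gen R P" by (auto simp: ideal_gen_def)
    then have PP': "P = P' \<inter> C" using P' by (auto simp: P_def)
    have span: "R \<subseteq> P'.cl ?S" using fg P'(3) by (intro spanning[OF P'(1)] vcl[OF P'(1) PP']) auto
    obtain q where q: "q \<in> R" "q \<notin> ?S" "P'.indep (insert q ?S)"
      using Q.indep_grow[OF P'(1) \<open>P' \<subset> Q\<close> _ indS] finE by blast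
    have SR: "?S \<subseteq> R" using fg EC C_R by auto
    have "card (insert q ?S) \<le> card ?S"
      using finE SR q span by (intro P'.steinitz) auto
    then show False using q(2) finE by simp
  qed
  moreover have "ideal_gen R P \<subseteq> Q" using prQ by (auto simp: ideal_gen_def P_def prime_in_def)
  ultimately show ?thesis using ht prQ unfolding minimal_prime_over_def P_def by blast
qed

end

theorem theorem2p19:
  fixes n :: nat and s t :: "nat \<Rightarrow> mpoly" and gam del :: "nat \<Rightarrow> bool"
  assumes "n \<ge> 3"
    and "\<forall>i<n-2. s i \<in> Apoly n \<and> t i \<in> Apoly n \<and> t i \<noteq> 0 \<and> coprime_in n (s i) (t i)"
    and "alg_indep (n-2) (\<lambda>i. Fract (s i) (t i))"
    and "dense_seq n gam del"
  shows
    "(\<forall>I Q. ideal_in (Cgam n s t del) I \<longrightarrow>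
        minimal_prime_over (Agam n s t gam del) (ideal_gen (Agam n s t gam del) I) Q \<longrightarrow>
        poisson_prime (Agam n s t gam del) (pbr n s t) Q)
     \<and> (\<forall>Q. poisson_prime (Agam n s t gam del) (pbr n s t) Q \<and> Q \<noteq> {0} \<and>
          proper_pp (Agam n s t gam del) (pbr n s t) Q \<longrightarrow>
          height_in (Agam n s t gam del) Q = height_in (Cgam n s t del) (Q \<inter> Cgam n s t del))
     \<and> (\<forall>Q. poisson_prime (Agam n s t gam del) (pbr n s t) Q \<and> Q \<noteq> {0} \<and>
          proper_pp (Agam n s t gam del) (pbr n s t) Q \<longrightarrow>
          minimal_prime_over (Agam n s t gam del)
            (ideal_gen (Agam n s t gam del) (Q \<inter> Cgam n s t del)) Q)"
proof -
  have "s i \<noteq> 0" if "i < n - 2" for i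
    using alg_indep_nonzero[OF assms(3) that] by (auto simp: fract_collapse)
  then interpret poisson_setting n s t gam del
    using assms by unfold_locales (auto simp: dense_seq_def)
  show ?thesis using minimal_prime_poisson proper_poisson_prime by blast
qed

end
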